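(* Let $F\subset\operatorname{Sym}^2(\mathbb R^n)$ be a convex Dirichlet set and let $\Omega\subset\mathbb R^n$ be open and bounded with smooth boundary. Let $\phi:\partial\Omega\times\mathbb R^m\to\mathbb R$ be continuous and such that $\phi_\tau(\cdot)=\phi(\tau,\cdot)$ is convex for each $\tau\in\partial\Omega$. Assume that $\Omega$ is strictly $\overrightarrow{F}$-convex and strictly $\overrightarrow{\tilde F}$-convex and that $\{\phi^*_\tau\}_{\tau\in\partial\Omega}$ is locally comparable. Define, on $\overline\Omega\times\mathbb R^m$, $$\Phi:=\sup\{\zeta\in USC(\overline\Omega\times\mathbb R^m):\ \zeta|_{\Omega\times\mathbb R^m}\text{ is }F\star\mathcal P\text{-subharmonic and }\zeta|_{\partial\Omega\times\mathbb R^m}\le\phi\}.$$ Then $\Phi$ is $F\star\mathcal P$-subharmonic on $\Omega\times\mathbb R^m$, and $\Phi|_{\partial\Omega\times\mathbb R^m}=\phi$.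
   Context: $\operatorname{Sym}^2(\mathbb R^n)$ is the space of real symmetric $n\times n$ matrices and $\mathcal P=\mathcal P_n$ its subset of positive semidefinite matrices. A Dirichlet set is a non-empty, proper, closed subset $F\subset\operatorname{Sym}^2(\mathbb R^n)$ with $F+\mathcal P_n\subset F$; it is a convex Dirichlet set if it is also convex. $USC(Z)$ is the set of upper-semicontinuous functions $Z\to\mathbb R\cup\{-\infty\}$. For $Y\subset\mathbb R^N$ open, $G\subset\operatorname{Sym}^2(\mathbb R^N)$ a Dirichlet set and $f\in USC(Y)$, a test function for $f$ at $x_0\in Y$ is a smooth function $g$ on a neighbourhood of $x_0$ with $g\ge f$ there and $g(x_0)=f(x_0)$. The function $f$ is $G$-subharmonic if $\operatorname{Hess}_{x_0}(g)\in G$ for every $x_0\in Y$ and every test function $g$ for $f$ at $x_0$. Product: write $A\in\operatorname{Sym}^2(\mathbb R^{n+m})$ in blocks as $A=\begin{pmatrix}B&C\\C^T&D\end{pmatrix}$ with $B\in\operatorname{Sym}^2(\mathbb R^n)$, $D\in\operatorname{Sym}^2(\mathbb R^m)$. For a real $m\times n$ matrix $\Gamma$ put $i_\Gamma^*A=B+C\Gamma+\Gamma^TC^T+\Gamma^TD\Gamma$. Then $F\star\mathcal P$ is the Dirichlet set of all $A$ with $D\in\mathcal P_m$ and $i_\Gamma^*A\in F$ for all $\Gamma$. Dual: $\tilde F$ is the complement of $-\operatorname{Int}(F)$ in $\operatorname{Sym}^2(\mathbb R^n)$; it is again a Dirichlet set. Ray set: for a Dirichlet set $G$ and $B\in\operatorname{Sym}^2(\mathbb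 R^n)$ let $\overrightarrow{G_B}=\{A:\exists\lambda_0\text{ with }B+\lambda A\in G\ \forall\lambda\ge\lambda_0\}$. The closure of $\overrightarrow{G_B}$ is independent of $B$, and is the ray set $\overrightarrow G$. Boundary convexity: a local defining function for $\partial\Omega$ near $\tau\in\partial\Omega$ is a smooth function $\rho$ on a neighbourhood $U$ of $\tau$ with $\Omega\cap U=\{\rho<0\}$ and $\nabla\rho\ne0$. $\Omega$ is (strictly) $\overrightarrow G$-convex if for all $\tau\in\partial\Omega$, with $T=T_\tau\partial\Omega$ and $\rho$ a local defining function near $\tau$, one has $\operatorname{Hess}_\tau\rho|_T=B|_T$ (as quadratic forms on $T$) for some $B\in\operatorname{Int}(\overrightarrow G)$. Legendre transform: $\phi_\tau^*(u)=\sup_{y\in\mathbb R^m}\{y\cdot u-\phi_\tau(y)\}$. The family $\{\phi_\tau^*\}_{\tau\in\partial\Omega}$ is locally comparable if (1) for every $u\in\mathbb R^m$ there is $C$ with $|\phi_\tau^*(u)-\phi^*_{\tau'}(u)|\le C$ for all $\tau,\tau'\in\partial\Omega$ (allowing the possibility that $\phi_\tau^*(u)=\infty$ for some $\tau$, in which case it is required that $\phi^*_{\tau'}(u)=\infty$ for all $\tau'$); and (2) for each $\tau$ the set of $u$ with $\phi_\tau^*(u)$ finite is open in $\mathbb R^m$. *)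

theory Defs
  imports "HOL-Analysis.Analysis"
begin

definition sym_mats :: "(real^'n^'n) set" where
  "sym_mats = {A. transpose A = A}"

definition psd_mats :: "(real^'n^'n) set" where
  "psd_mats = {A \<in> sym_mats. \<forall>x. 0 \<le> x \<bullet> (A *v x)}"

text \<open>Interior relative to the space of symmetric matrices; as a subset of \<^typ>\<open>real^'n^'n\<close>
  a set of symmetric matrices has empty interior as soon as the size is at least two.\<close>
definition sym_interior :: "(real^'n^'n) set \<Rightarrow> (real^'n^'n) set" where
  "sym_interior G = (top_of_set sym_mats) interior_of G"

definition dirichlet_set :: "(real^'n^'n) set \<Rightarrow> bool" where
  "dirichlet_set G \<longleftrightarrow> G \<subseteq> sym_mats \<and> G \<noteq> {} \<and> G \<noteq> sym_mats \<and> closed G \<and>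
     (\<forall>A\<in>G. \<forall>P\<in>psd_mats. A + P \<in> G)"

definition dual_set :: "(real^'n^'n) set \<Rightarrow> (real^'n^'n) set" where
  "dual_set G = sym_mats - uminus ` sym_interior G"

definition ray_from :: "(real^'n^'n) set \<Rightarrow> real^'n^'n \<Rightarrow> (real^'n^'n) set" where
  "ray_from G B = {A \<in> sym_mats. \<exists>t\<^sub>0::real. \<forall>t\<ge>t\<^sub>0. B + t *\<^sub>R A \<in> G}"

text \<open>The base point is irrelevant, see \<open>ray_set_eq\<close> below.\<close>
definition ray_set :: "(real^'n^'n) set \<Rightarrow> (real^'n^'n) set" where
  "ray_set G = closure (ray_from G 0)"

lemma sym_mats_add: "A \<in> sym_mats \<Longrightarrow> B \<in> sym_mats \<Longrightarrow> A + B \<in> sym_mats"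
  by (auto simp: sym_mats_def transpose_def vec_eq_iff)

lemma sym_mats_diff: "A \<in> sym_mats \<Longrightarrow> B \<in> sym_mats \<Longrightarrow> A - B \<in> sym_mats"
  by (auto simp: sym_mats_def transpose_def vec_eq_iff)

lemma sym_mats_scaleR: "A \<in> sym_mats \<Longrightarrow> c *\<^sub>R A \<in> sym_mats"
  by (auto simp: sym_mats_def transpose_def vec_eq_iff)

lemma sym_mats_mat: "mat c \<in> sym_mats"
  by (simp add: sym_mats_def transpose_mat)

lemma zero_sym_mats: "0 \<in> sym_mats"
  by (simp add: sym_mats_def transpose_def vec_eq_iff)

lemma sym_mats_shift_psd:
  fixes C :: "real^'n^'n"
  assumes C: "C \<in> sym_mats"
  obtains K where "\<And>t. t \<ge> K \<Longrightarrow> C + t *\<^sub>R mat 1 \<in> psd_mats"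
proof -
  obtain K where K: "\<And>x. norm (C *v x) \<le> norm x * K"
    using bounded_linear.bounded[OF matrix_vector_mul_bounded_linear] by blast
  have "C + t *\<^sub>R mat 1 \<in> psd_mats" if "t \<ge> K" for t
  proof -
    have "0 \<le> x \<bullet> ((C + t *\<^sub>R mat 1) *v x)" for x
    proof -
      have "\<bar>x \<bullet> (C *v x)\<bar> \<le> norm x * (norm x * K)"
        by (meson Cauchy_Schwarz_ineq2 K mult_left_mono norm_ge_zero order_trans)
      also have "\<dots> = K * (x \<bullet> x)"
        by (simp add: dot_square_norm power2_eq_square)
      also have "\<dots> \<le> t * (x \<bullet> x)"
        using that by (intro mult_right_mono) auto
      finally have "0 \<le> x \<bullet> (C *v x) + t * (x \<bullet> x)" by linarith
      then show ?thesis
        by (simp add: matrix_vector_mult_add_rdistrib inner_add_right scaleR_matrix_vector_assoc[symmetric])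
    qed
    then show ?thesis
      by (simp add: psd_mats_def C sym_mats_add sym_mats_scaleR sym_mats_mat)
  qed
  then show ?thesis using that by blast
qed

lemma closure_ray_from_mono:
  fixes G :: "(real^'n^'n) set"
  assumes G: "dirichlet_set G" and B: "B \<in> sym_mats" "B' \<in> sym_mats"
  shows "closure (ray_from G B) \<subseteq> closure (ray_from G B')"
proof (rule closure_minimal)
  show "ray_from G B \<subseteq> closure (ray_from G B')"
  proof
    fix A assume A: "A \<in> ray_from G B"
    then obtain l where l: "\<And>r. r \<ge> l \<Longrightarrow> B + r *\<^sub>R A \<in> G" and As: "A \<in> sym_mats"
      by (auto simp: ray_from_def)
    obtain K where K: "\<And>t. t \<ge> K \<Longrightarrow> (B' - B) + t *\<^sub>R mat 1 \<in> psd_mats"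
      using sym_mats_shift_psd sym_mats_diff B by metis
    have shift: "A + e *\<^sub>R mat 1 \<in> ray_from G B'" if "e > 0" for e
    proof -
      have "B' + r *\<^sub>R (A + e *\<^sub>R mat 1) \<in> G" if r: "r \<ge> max l (K / e)" for r
      proof -
        have "r * e \<ge> K" using r \<open>e > 0\<close> by (simp add: divide_le_eq)
        then have "(B + r *\<^sub>R A) + ((B' - B) + (r * e) *\<^sub>R mat 1) \<in> G"
          using G K[of "r * e"] l[of r] r unfolding dirichlet_set_def by (meson max.bounded_iff)
        then show ?thesis by (simp add: algebra_simps)
      qed
      then show ?thesis
        unfolding ray_from_def using As sym_mats_add sym_mats_scaleR sym_mats_mat by blast
    qed
    have "((\<lambda>k. A + inverse (real (Suc k)) *\<^sub>R mat 1) \<longlongrightarrow> A + 0 *\<^sub>R mat 1) sequentially"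
      by (intro tendsto_intros LIMSEQ_inverse_real_of_nat)
    then show "A \<in> closure (ray_from G B')"
      unfolding closure_sequential using shift
      by (intro exI[of _ "\<lambda>k. A + inverse (real (Suc k)) *\<^sub>R mat 1"]) auto
  qed
qed simp

lemma ray_set_eq:
  assumes "dirichlet_set G" "B \<in> sym_mats"
  shows "ray_set G = closure (ray_from G B)"
  unfolding ray_set_def using closure_ray_from_mono assms zero_sym_mats by blast

text \<open>\<open>\<real>\<^sup>n\<^sup>+\<^sup>m\<close> is \<^typ>\<open>real^('n+'m)\<close>, with \<open>Inl\<close> indexing the first block and \<open>Inr\<close> the second.\<close>

definition vjoin :: "real^'n \<Rightarrow> real^'m \<Rightarrow> real^('n::finite+'m::finite)" where
  "vjoin x y = (\<chi> k. case k of Inl i \<Rightarrow> x $ i | Inr j \<Rightarrow> y $ j)"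

definition cyl :: "(real^'n) set \<Rightarrow> (real^('n::finite+'m::finite)) set" where
  "cyl S = {vjoin x y | x y. x \<in> S}"

definition block_B :: "real^('n::finite+'m::finite)^('n::finite+'m::finite) \<Rightarrow> real^'n^'n" where
  "block_B A = (\<chi> i j. A $ Inl i $ Inl j)"

definition block_C :: "real^('n::finite+'m::finite)^('n::finite+'m::finite) \<Rightarrow> real^'m^'n" where
  "block_C A = (\<chi> i j. A $ Inl i $ Inr j)"

definition block_D :: "real^('n::finite+'m::finite)^('n::finite+'m::finite) \<Rightarrow> real^'m^'m" where
  "block_D A = (\<chi> i j. A $ Inr i $ Inr j)"

definition slice :: "real^'n^'m \<Rightarrow> real^('n::finite+'m::finite)^('n::finite+'m::finite) \<Rightarrow> real^'n^'n" where
  "slice \<Gamma> A = block_B A + block_C A ** \<Gamma> + transpose \<Gamma> ** transpose (block_C A)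
     + transpose \<Gamma> ** block_D A ** \<Gamma>"

definition star_psd :: "(real^'n^'n) set \<Rightarrow> (real^('n::finite+'m::finite)^('n::finite+'m::finite)) set" where
  "star_psd F = {A \<in> sym_mats. block_D A \<in> psd_mats \<and> (\<forall>\<Gamma>. slice \<Gamma> A \<in> F)}"

definition pderiv_at :: "'N::finite \<Rightarrow> (real^'N \<Rightarrow> real) \<Rightarrow> real^'N \<Rightarrow> real" where
  "pderiv_at i f x = frechet_derivative f (at x) (axis i 1)"

primrec Ck_on :: "nat \<Rightarrow> (real^'N) set \<Rightarrow> (real^'N \<Rightarrow> real) \<Rightarrow> bool" where
  "Ck_on 0 U f \<longleftrightarrow> continuous_on U f"
| "Ck_on (Suc k) U f \<longleftrightarrow> (\<forall>x\<in>U. f differentiable (at x)) \<and> (\<forall>i. Ck_on k U (pderiv_at i f))"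

text \<open>Only used for open \<open>U\<close>.\<close>
definition smooth_on :: "(real^'N) set \<Rightarrow> (real^'N \<Rightarrow> real) \<Rightarrow> bool" where
  "smooth_on U f \<longleftrightarrow> (\<forall>k. Ck_on k U f)"

definition grad :: "(real^'N \<Rightarrow> real) \<Rightarrow> real^'N \<Rightarrow> real^'N" where
  "grad f x = (\<chi> i. pderiv_at i f x)"

definition hess :: "(real^'N \<Rightarrow> real) \<Rightarrow> real^'N \<Rightarrow> real^'N^'N" where
  "hess f x = (\<chi> i j. pderiv_at i (pderiv_at j f) x)"

text \<open>Functions on a set \<open>Z\<close> are total functions of which only the values on \<open>Z\<close> matter.\<close>
definition usc_on :: "(real^'N) set \<Rightarrow> (real^'N \<Rightarrow> ereal) \<Rightarrow> bool" where
  "usc_on Z f \<longleftrightarrow> (\<forall>z\<in>Z. f z < \<infinity>) \<and>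
     (\<forall>a::real. openin (top_of_set Z) {z \<in> Z. f z < ereal a})"

definition test_function ::
    "(real^'N) set \<Rightarrow> (real^'N \<Rightarrow> ereal) \<Rightarrow> real^'N \<Rightarrow> (real^'N \<Rightarrow> real) \<Rightarrow> bool" where
  "test_function Y f x g \<longleftrightarrow> (\<exists>U. open U \<and> x \<in> U \<and> U \<subseteq> Y \<and> smooth_on U g \<and>
     (\<forall>z\<in>U. f z \<le> ereal (g z)) \<and> f x = ereal (g x))"

definition subharmonic_on ::
    "(real^'N^'N) set \<Rightarrow> (real^'N) set \<Rightarrow> (real^'N \<Rightarrow> ereal) \<Rightarrow> bool" where
  "subharmonic_on G Y f \<longleftrightarrow> usc_on Y f \<and>
     (\<forall>x\<in>Y. \<forall>g. test_function Y f x g \<longrightarrow> hess g x \<in> G)"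

definition local_defining_function ::
    "(real^'n) set \<Rightarrow> real^'n \<Rightarrow> (real^'n) set \<Rightarrow> (real^'n \<Rightarrow> real) \<Rightarrow> bool" where
  "local_defining_function \<Omega> \<tau> U \<rho> \<longleftrightarrow> open U \<and> \<tau> \<in> U \<and> smooth_on U \<rho> \<and>
     \<Omega> \<inter> U = {x \<in> U. \<rho> x < 0} \<and> (\<forall>x\<in>U. grad \<rho> x \<noteq> 0)"

definition smooth_boundary :: "(real^'n) set \<Rightarrow> bool" where
  "smooth_boundary \<Omega> \<longleftrightarrow> (\<forall>\<tau>\<in>frontier \<Omega>. \<exists>U \<rho>. local_defining_function \<Omega> \<tau> U \<rho>)"

text \<open>The tangent space to the boundary at \<open>\<tau>\<close> is the orthogonal complement of \<open>grad \<rho> \<tau>\<close>.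
  The condition does not depend on \<open>\<rho>\<close>: on that space, the Hessians of two local defining
  functions are positive multiples of each other, and \<open>R\<close> will be a cone.\<close>
definition strictly_bdry_convex :: "(real^'n^'n) set \<Rightarrow> (real^'n) set \<Rightarrow> bool" where
  "strictly_bdry_convex R \<Omega> \<longleftrightarrow>
     (\<forall>\<tau>\<in>frontier \<Omega>. \<forall>U \<rho>. local_defining_function \<Omega> \<tau> U \<rho> \<longrightarrow>
        (\<exists>B\<in>sym_interior R. \<forall>v. grad \<rho> \<tau> \<bullet> v = 0 \<longrightarrow> v \<bullet> (hess \<rho> \<tau> *v v) = v \<bullet> (B *v v)))"

definition legendre :: "(real^'m \<Rightarrow> real) \<Rightarrow> real^'m \<Rightarrow> ereal" where
  "legendre f u = (SUP y. ereal (y \<bullet> u - f y))"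

text \<open>The case distinction in the first clause is needed because \<open>\<infinity> - \<infinity> = \<infinity>\<close> in \<^typ>\<open>ereal\<close>.\<close>
definition locally_comparable :: "'t set \<Rightarrow> ('t \<Rightarrow> real^'m \<Rightarrow> ereal) \<Rightarrow> bool" where
  "locally_comparable T f \<longleftrightarrow>
     (\<forall>u. \<exists>C::real. \<forall>\<tau>\<in>T. \<forall>\<tau>'\<in>T.
        (f \<tau> u = \<infinity> \<and> f \<tau>' u = \<infinity>) \<or>
        (f \<tau> u \<noteq> \<infinity> \<and> f \<tau>' u \<noteq> \<infinity> \<and> \<bar>f \<tau> u - f \<tau>' u\<bar> \<le> ereal C)) \<and>
     (\<forall>\<tau>\<in>T. open {u. \<bar>f \<tau> u\<bar> \<noteq> \<infinity>})"

definition perron_family ::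
    "(real^'n^'n) set \<Rightarrow> (real^'n) set \<Rightarrow> (real^'n \<Rightarrow> real^'m \<Rightarrow> real) \<Rightarrow> (real^('n::finite+'m::finite) \<Rightarrow> ereal) set" where
  "perron_family F \<Omega> \<phi> = {\<zeta>. usc_on (cyl (closure \<Omega>)) \<zeta> \<and> subharmonic_on (star_psd F) (cyl \<Omega>) \<zeta> \<and>
     (\<forall>\<tau>\<in>frontier \<Omega>. \<forall>y. \<zeta> (vjoin \<tau> y) \<le> ereal (\<phi> \<tau> y))}"

definition perron_sup ::
    "(real^'n^'n) set \<Rightarrow> (real^'n) set \<Rightarrow> (real^'n \<Rightarrow> real^'m \<Rightarrow> real) \<Rightarrow> real^('n::finite+'m::finite) \<Rightarrow> ereal" where
  "perron_sup F \<Omega> \<phi> z = (SUP \<zeta>\<in>perron_family F \<Omega> \<phi>. \<zeta> z)"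

end

theory Submission
  imports Defs
begin

text \<open>All members of the Perron family lie below smooth strict barriers, and a smooth barrier can be
  compared with a subharmonic function directly at an interior maximum, without any theorem on sums:
  if \<open>\<zeta> + v\<close> has an interior maximum in the slice \<open>y = y\<^sub>1\<close>, penalizing by a multiple of
  \<open>|y - y\<^sub>1|\<^sup>2\<close> yields a test function whose Hessian has \<open>- Hess v\<close> as its first block, so that
  \<open>- Hess v \<in> F\<close>. Strict convexity of the boundary with respect to the ray set of the dual provides
  such \<open>v\<close> near each boundary point. Hence the upper semicontinuous envelope of the supremum still has
  boundary values at most \<open>\<phi>\<close>, so it belongs to the family and equals the supremum.

  For the lower bound take a subgradient \<open>u\<close> of \<open>\<phi>\<^sub>\<tau>\<close> at \<open>y\<^sub>0\<close>. Local comparability makes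
  \<open>\<phi>\<^sub>\<tau>\<^sub>' - u \<bullet> y\<close> coercive uniformly in \<open>\<tau>'\<close>, so the value of its minimum varies continuously with
  \<open>\<tau>'\<close>. Therefore \<open>u \<bullet> y + h x\<close> is a competitor nearly attaining \<open>\<phi>\<^sub>\<tau> y\<^sub>0\<close>, where \<open>h\<close> is the maximum of a
  boundary barrier for \<open>F\<close> and a large parabola.\<close>

section \<open>Smooth functions and their Hessians\<close>

text \<open>Ray sets enter because the barriers have to be steep: near a boundary point
  \<open>w\<close> is multiplied by a constant \<open>C\<close> that beats an a priori bound on the
  family (from above) or sinks below a parabola (from below), so \<open>C\<close> times the Hessian
  of \<open>w\<close> must stay in the interior for every large \<open>C\<close>. The unbounded
  second factor shapes both halves. From above, the penalty only enters the last block of the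
  Hessian, which the slice with \<Gamma> = 0 does not see, so its coefficient may be as large as the
  cylinder requires. From below, all pieces of a competitor have the same slope \<open>u\<close> in
  y, so gluing happens in x alone; the Hessian of a smooth piece is padded by zeros, and every
  \<Gamma> returns its first block. The price is an affine bound valid for all y at once at boundary
  points near \<tau>. The subgradient gives it at \<tau> only; nearby slopes, available since the
  domain of finiteness is open, confine the remaining comparison to a compact set of y. Topology in
  the space of symmetric matrices is reduced to order: A is interior to a monotone set iff A - d I
  belongs to it for some d > 0.\<close>

lemma pderiv_at_eq:
  assumes "(f has_derivative f') (at x)"
  shows "pderiv_at i f x = f' (axis i 1)"
  using frechet_derivative_at[OF assms] by (simp add: pderiv_at_def)

lemma has_derivative_grad:
  fixes f :: "real^'N \<Rightarrow> real"
  assumes "f differentiable (at x)"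
  shows "(f has_derivative (\<lambda>h. grad f x \<bullet> h)) (at x)"
proof -
  from assms obtain f' where f': "(f has_derivative f') (at x)"
    by (auto simp: differentiable_def)
  then interpret bounded_linear f' by (rule has_derivative_bounded_linear)
  have "f' h = grad f x \<bullet> h" for h
  proof -
    have "f' h = f' (\<Sum>i\<in>UNIV. (h $ i) *\<^sub>R axis i 1)"
      by (simp add: basis_expansion scalar_mult_eq_scaleR[symmetric])
    also have "\<dots> = (\<Sum>i\<in>UNIV. h $ i * f' (axis i 1))"
      by (simp add: sum scaleR)
    also have "\<dots> = grad f x \<bullet> h"
      by (simp add: grad_def inner_vec_def pderiv_at_eq[OF f'] mult.commute)
    finally show ?thesis .
  qed
  then have "f' = (\<lambda>h. grad f x \<bullet> h)" by auto
  with f' show ?thesis by simp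
qed

lemma grad_nth [simp]: "grad f x $ i = pderiv_at i f x"
  by (simp add: grad_def)

lemma hess_nth [simp]: "hess f x $ i $ j = pderiv_at i (pderiv_at j f) x"
  by (simp add: hess_def)

text \<open>A formula for a first derivative is known only on the open set where the function is
  smooth. Agreement there is enough to differentiate the formula once more; the Hessian rules for
  sums, products and pullbacks rest on this.\<close>

lemma pderiv_at_cong:
  assumes "open U" "x \<in> U" "\<And>y. y \<in> U \<Longrightarrow> f y = g y"
  shows "pderiv_at i f x = pderiv_at i g x"
proof -
  have "(f has_derivative f') (at x) \<longleftrightarrow> (g has_derivative f') (at x)" for f'
    using has_derivative_transform_within_open[of f f' x UNIV U g]
      has_derivative_transform_within_open[of g f' x UNIV U f] assms by auto
  then show ?thesis by (simp add: pderiv_at_def frechet_derivative_def)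
qed

lemma differentiable_cong_open:
  assumes "open U" "x \<in> U" "\<And>y. y \<in> U \<Longrightarrow> f y = g y" "f differentiable (at x)"
  shows "g differentiable (at x)"
  using assms has_derivative_transform_within_open[of f _ x UNIV U g]
  unfolding differentiable_def by blast

lemma Ck_on_cong:
  assumes "open U" "\<And>x. x \<in> U \<Longrightarrow> f x = g x" "Ck_on k U f"
  shows "Ck_on k U g"
  using assms(2,3)
proof (induction k arbitrary: f g)
  case 0
  then show ?case by (simp cong: continuous_on_cong)
next
  case (Suc k)
  have "g differentiable (at x)" if "x \<in> U" for x
    using Suc.prems that differentiable_cong_open[OF assms(1)] by (metis Ck_on.simps(2))
  moreover have "Ck_on k U (pderiv_at i g)" for i
    using Suc.IH[of "pderiv_at i f" "pderiv_at i g"] Suc.prems pderiv_at_cong[OF assms(1)]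
    by (metis Ck_on.simps(2))
  ultimately show ?case by simp
qed

lemma Ck_on_subset: "Ck_on k U f \<Longrightarrow> V \<subseteq> U \<Longrightarrow> Ck_on k V f"
  by (induction k arbitrary: f) (auto intro: continuous_on_subset)

lemma Ck_on_Suc_imp: "Ck_on (Suc k) U f \<Longrightarrow> Ck_on k U f"
proof (induction k arbitrary: f)
  case 0
  then show ?case
    by (auto intro!: continuous_at_imp_continuous_on differentiable_imp_continuous_within)
next
  case (Suc k)
  then show ?case by (metis Ck_on.simps(2))
qed

lemma has_derivative_grad_on:
  assumes "Ck_on (Suc k) U f" "x \<in> U"
  shows "(f has_derivative (\<lambda>h. grad f x \<bullet> h)) (at x)"
  using assms by (intro has_derivative_grad) simp

lemma has_derivative_add_grad:
  assumes "Ck_on (Suc k) U f" "Ck_on (Suc k) U g" "x \<in> U"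
  shows "((\<lambda>x. f x + g x) has_derivative (\<lambda>h. (grad f x + grad g x) \<bullet> h)) (at x)"
  using has_derivative_add[OF has_derivative_grad_on[OF assms(1,3)] has_derivative_grad_on[OF assms(2,3)]]
  by (simp add: inner_add_left)

lemma has_derivative_mult_grad:
  assumes "Ck_on (Suc k) U f" "Ck_on (Suc k) U g" "x \<in> U"
  shows "((\<lambda>x. f x * g x) has_derivative (\<lambda>h. (f x *\<^sub>R grad g x + g x *\<^sub>R grad f x) \<bullet> h)) (at x)"
  using has_derivative_mult[OF has_derivative_grad_on[OF assms(1,3)] has_derivative_grad_on[OF assms(2,3)]]
  by (simp add: inner_add_left mult.commute)

lemma inner_axis_one [simp]: "v \<bullet> axis i (1::real) = v $ i"
  by (simp add: inner_axis)

lemma Ck_on_const: "Ck_on k U (\<lambda>_. c)"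
proof (induction k arbitrary: c)
  case (Suc k)
  have "pderiv_at i (\<lambda>_. c) = (\<lambda>_. 0)" for i :: 'a
    by (rule ext, subst pderiv_at_eq[of _ "\<lambda>_. 0"]) auto
  then show ?case using Suc by simp
qed auto

lemma Ck_on_add:
  assumes "open U"
  shows "Ck_on k U f \<Longrightarrow> Ck_on k U g \<Longrightarrow> Ck_on k U (\<lambda>x. f x + g x)"
proof (induction k arbitrary: f g)
  case 0
  then show ?case by (auto intro: continuous_intros)
next
  case (Suc k)
  note D = has_derivative_add_grad[OF Suc.prems]
  have "Ck_on k U (pderiv_at i (\<lambda>x. f x + g x))" for i
    by (rule Ck_on_cong[OF assms, of "\<lambda>x. pderiv_at i f x + pderiv_at i g x"])
      (use Suc in \<open>auto simp: pderiv_at_eq[OF D]\<close>)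
  then show ?case using D by (auto simp: differentiable_def)
qed

lemma Ck_on_mult:
  assumes "open U"
  shows "Ck_on k U f \<Longrightarrow> Ck_on k U g \<Longrightarrow> Ck_on k U (\<lambda>x. f x * g x)"
proof (induction k arbitrary: f g)
  case 0
  then show ?case by (auto intro: continuous_intros)
next
  case (Suc k)
  note D = has_derivative_mult_grad[OF Suc.prems]
  \<comment> \<open>The product rule leaves one factor undifferentiated, so the induction hypothesis
    also needs \<open>f\<close> and \<open>g\<close> themselves at order \<open>k\<close>.\<close>
  note C = Suc.prems[THEN Ck_on_Suc_imp]
  have "Ck_on k U (pderiv_at i (\<lambda>x. f x * g x))" for i
    by (rule Ck_on_cong[OF assms, of "\<lambda>x. f x * pderiv_at i g x + g x * pderiv_at i f x"])
      (use Suc.prems C in \<open>auto simp: pderiv_at_eq[OF D] intro!: Ck_on_add[OF assms] Suc.IH\<close>)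
  then show ?case using D by (auto simp: differentiable_def)
qed

lemma Ck_on_affine: "Ck_on k U (\<lambda>x. a \<bullet> x + b)"
proof (cases k)
  case 0
  then show ?thesis by (auto intro!: continuous_intros)
next
  case (Suc l)
  have D: "((\<lambda>x. a \<bullet> x + b) has_derivative (\<lambda>h. a \<bullet> h)) (at x)" for x
    by (auto intro!: derivative_eq_intros)
  have "pderiv_at i (\<lambda>x. a \<bullet> x + b) = (\<lambda>_. a $ i)" for i
    by (rule ext) (simp add: pderiv_at_eq[OF D])
  with D show ?thesis using Suc Ck_on_const by (auto simp: differentiable_def)
qed

lemma pderiv_at_sqdist: "pderiv_at i (\<lambda>x. (x - c) \<bullet> (x - c)) x = 2 * (x - c) $ i"
proof -
  have D: "((\<lambda>x. (x - c) \<bullet> (x - c)) has_derivative (\<lambda>h. 2 * ((x - c) \<bullet> h))) (at x)"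
    by (auto intro!: derivative_eq_intros simp: inner_commute)
  show ?thesis by (simp add: pderiv_at_eq[OF D])
qed

lemma Ck_on_sqdist: "Ck_on k U (\<lambda>x. (x - c) \<bullet> (x - c))"
proof (cases k)
  case 0
  then show ?thesis by (auto intro!: continuous_intros)
next
  case (Suc l)
  have "pderiv_at i (\<lambda>x. (x - c) \<bullet> (x - c)) = (\<lambda>x. axis i 2 \<bullet> x + - (2 * c $ i))" for i
    unfolding pderiv_at_sqdist by (rule ext) (simp add: inner_axis' algebra_simps)
  then have "Ck_on l U (pderiv_at i (\<lambda>x. (x - c) \<bullet> (x - c)))" for i
    using Ck_on_affine by metis
  then show ?thesis using Suc by simp
qed

lemma smooth_on_const: "smooth_on U (\<lambda>_. d)"
  and smooth_on_affine: "smooth_on U (\<lambda>x. a \<bullet> x + b)"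
  and smooth_on_sqdist: "smooth_on U (\<lambda>x. (x - c) \<bullet> (x - c))"
  by (simp_all add: smooth_on_def Ck_on_const Ck_on_affine Ck_on_sqdist)

lemma smooth_on_add: "open U \<Longrightarrow> smooth_on U f \<Longrightarrow> smooth_on U g \<Longrightarrow> smooth_on U (\<lambda>x. f x + g x)"
  and smooth_on_mult: "open U \<Longrightarrow> smooth_on U f \<Longrightarrow> smooth_on U g \<Longrightarrow> smooth_on U (\<lambda>x. f x * g x)"
  by (simp_all add: smooth_on_def Ck_on_add Ck_on_mult)

lemma smooth_on_cmult: "open U \<Longrightarrow> smooth_on U f \<Longrightarrow> smooth_on U (\<lambda>x. c * f x)"
  by (intro smooth_on_mult smooth_on_const)

lemma smooth_on_diff: "open U \<Longrightarrow> smooth_on U f \<Longrightarrow> smooth_on U g \<Longrightarrow> smooth_on U (\<lambda>x. f x - g x)"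
  using smooth_on_add[of U f "\<lambda>x. (-1) * g x"] smooth_on_cmult[of U g "-1"] by simp

lemma smooth_on_subset: "smooth_on U f \<Longrightarrow> V \<subseteq> U \<Longrightarrow> smooth_on V f"
  by (auto simp: smooth_on_def intro: Ck_on_subset)

lemma smooth_on_pderiv: "smooth_on U f \<Longrightarrow> smooth_on U (pderiv_at i f)"
  unfolding smooth_on_def by (metis Ck_on.simps(2))

lemma smooth_on_imp_continuous: "smooth_on U f \<Longrightarrow> continuous_on U f"
  unfolding smooth_on_def by (metis Ck_on.simps(1))

lemma smooth_on_has_derivative:
  "smooth_on U f \<Longrightarrow> x \<in> U \<Longrightarrow> (f has_derivative (\<lambda>h. grad f x \<bullet> h)) (at x)"
  unfolding smooth_on_def using has_derivative_grad_on by blast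

lemma continuous_on_hess:
  assumes "smooth_on U f"
  shows "continuous_on U (hess f)"
  unfolding hess_def
  by (intro continuous_on_vec_lambda smooth_on_imp_continuous smooth_on_pderiv assms)

lemma pderiv_at_add:
  assumes "smooth_on U f" "smooth_on U g" "x \<in> U"
  shows "pderiv_at i (\<lambda>x. f x + g x) x = pderiv_at i f x + pderiv_at i g x"
  by (subst pderiv_at_eq[OF has_derivative_add_grad[of 0 U]])
    (use assms in \<open>auto simp: smooth_on_def simp del: Ck_on.simps\<close>)

lemma pderiv_at_mult:
  assumes "smooth_on U f" "smooth_on U g" "x \<in> U"
  shows "pderiv_at i (\<lambda>x. f x * g x) x = f x * pderiv_at i g x + g x * pderiv_at i f x"
  by (subst pderiv_at_eq[OF has_derivative_mult_grad[of 0 U]])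
    (use assms in \<open>auto simp: smooth_on_def simp del: Ck_on.simps\<close>)

lemma hess_add:
  assumes "open U" "smooth_on U f" "smooth_on U g" "x \<in> U"
  shows "hess (\<lambda>x. f x + g x) x = hess f x + hess g x"
proof -
  have "pderiv_at i (pderiv_at j (\<lambda>x. f x + g x)) x
      = pderiv_at i (\<lambda>x. pderiv_at j f x + pderiv_at j g x) x" for i j
    by (rule pderiv_at_cong[OF assms(1,4)]) (rule pderiv_at_add[OF assms(2,3)])
  then show ?thesis
    by (simp add: vec_eq_iff pderiv_at_add[OF smooth_on_pderiv[OF assms(2)] smooth_on_pderiv[OF assms(3)] assms(4)])
qed

lemma hess_mult:
  assumes "open U" "smooth_on U f" "smooth_on U g" "x \<in> U"
  shows "hess (\<lambda>x. f x * g x) x = f x *\<^sub>R hess g x + g x *\<^sub>R hess f x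
    + (\<chi> i j. pderiv_at i f x * pderiv_at j g x + pderiv_at i g x * pderiv_at j f x)"
proof -
  have "pderiv_at i (pderiv_at j (\<lambda>x. f x * g x)) x
      = pderiv_at i (\<lambda>x. f x * pderiv_at j g x + g x * pderiv_at j f x) x" for i j
    by (rule pderiv_at_cong[OF assms(1,4)]) (rule pderiv_at_mult[OF assms(2,3)])
  then show ?thesis
    using assms by (simp add: vec_eq_iff pderiv_at_add[where U = U] pderiv_at_mult[where U = U]
        smooth_on_pderiv smooth_on_mult algebra_simps)
qed

lemma pderiv_at_const [simp]: "pderiv_at i (\<lambda>_. c) x = 0"
  by (subst pderiv_at_eq[of _ "\<lambda>_. 0"]) auto

lemma hess_const [simp]: "hess (\<lambda>_. c) x = 0"
proof -
  have "pderiv_at j (\<lambda>_. c) = (\<lambda>_. 0)" for j :: 'a by (rule ext) simp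
  then show ?thesis by (simp add: vec_eq_iff)
qed

lemma hess_affine [simp]: "hess (\<lambda>x. a \<bullet> x + b) x = 0"
proof -
  have D: "((\<lambda>x. a \<bullet> x + b) has_derivative (\<lambda>h. a \<bullet> h)) (at x)" for x
    by (auto intro!: derivative_eq_intros)
  have "pderiv_at i (\<lambda>x. a \<bullet> x + b) = (\<lambda>_. a $ i)" for i
    by (rule ext) (simp add: pderiv_at_eq[OF D])
  then show ?thesis by (simp add: vec_eq_iff)
qed

lemma hess_cmult:
  assumes "open U" "smooth_on U f" "x \<in> U"
  shows "hess (\<lambda>x. c * f x) x = c *\<^sub>R hess f x"
  using hess_mult[OF assms(1) smooth_on_const assms(2,3), of c] by (simp add: vec_eq_iff)

lemma hess_diff:
  assumes "open U" "smooth_on U f" "smooth_on U g" "x \<in> U"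
  shows "hess (\<lambda>x. f x - g x) x = hess f x - hess g x"
  using hess_add[OF assms(1,2) smooth_on_cmult[of U g "-1"] assms(4)] hess_cmult[of U g x "-1"] assms
  by simp

lemma hess_sqdist [simp]: "hess (\<lambda>x. (x - c) \<bullet> (x - c)) x = 2 *\<^sub>R mat 1"
proof -
  have D: "((\<lambda>x. 2 * (x - c) $ j) has_derivative (\<lambda>h. 2 * h $ j)) (at x)" for j
    using has_derivative_diff[OF bounded_linear_imp_has_derivative[OF bounded_linear_vec_nth] has_derivative_const]
    by (intro has_derivative_mult_right) simp
  have "pderiv_at j (\<lambda>x. (x - c) \<bullet> (x - c)) = (\<lambda>x. 2 * (x - c) $ j)" for j
    by (rule ext) (rule pderiv_at_sqdist)
  then have "hess (\<lambda>x. (x - c) \<bullet> (x - c)) x $ i $ j = 2 * (if j = i then 1 else 0)" for i j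
    unfolding hess_nth by (simp only: pderiv_at_eq[OF D]) (simp add: axis_def)
  then show ?thesis by (simp add: vec_eq_iff mat_def)
qed

section \<open>Restriction to lines: symmetry of the Hessian and the second derivative test\<close>

lemma has_real_derivative_along_line:
  fixes f :: "real^'N \<Rightarrow> real"
  assumes "smooth_on U f" "x + s *\<^sub>R w \<in> U"
  shows "((\<lambda>s. f (x + s *\<^sub>R w)) has_real_derivative (grad f (x + s *\<^sub>R w) \<bullet> w)) (at s)"
proof -
  have "((\<lambda>s. x + s *\<^sub>R w) has_derivative (\<lambda>h. h *\<^sub>R w)) (at s)"
    by (auto intro!: derivative_eq_intros)
  from has_derivative_compose[OF this smooth_on_has_derivative[OF assms]]
  show ?thesis unfolding has_field_derivative_def by (rule has_derivative_eq_rhs) auto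
qed

lemma has_real_derivative_along_axis:
  fixes f :: "real^'N \<Rightarrow> real"
  assumes "smooth_on U f" "x + s *\<^sub>R axis i 1 \<in> U"
  shows "((\<lambda>s. f (x + s *\<^sub>R axis i 1)) has_real_derivative pderiv_at i f (x + s *\<^sub>R axis i 1)) (at s)"
  using has_real_derivative_along_line[OF assms] by simp

text \<open>The mean value theorem, applied first in direction i and then in direction j, turns the
  second difference into h^2 times the mixed derivative at a nearby point; continuity moves that
  point to \<open>x\<close>.\<close>

lemma mixed_difference_quotient:
  fixes f :: "real^'N \<Rightarrow> real"
  assumes "open U" "smooth_on U f" "x \<in> U" "e > 0"
  obtains d where "d > 0" and "\<And>h. 0 < h \<Longrightarrow> h < d \<Longrightarrow>
    \<bar>f (x + h *\<^sub>R axis i 1 + h *\<^sub>R axis j 1) - f (x + h *\<^sub>R axis i 1) - f (x + h *\<^sub>R axis j 1) + f x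
      - h\<^sup>2 * pderiv_at j (pderiv_at i f) x\<bar> < e * h\<^sup>2"
proof -
  let ?g = "pderiv_at j (pderiv_at i f)"
  have "continuous_on U ?g"
    by (intro smooth_on_imp_continuous smooth_on_pderiv assms)
  then have "continuous (at x) ?g"
    using assms continuous_on_eq_continuous_at by blast
  then obtain d1 where d1: "d1 > 0" "\<And>y. dist y x < d1 \<Longrightarrow> dist (?g y) (?g x) < e"
    using \<open>e > 0\<close> unfolding continuous_at_eps_delta by (metis dist_commute)
  obtain d2 where d2: "d2 > 0" "ball x d2 \<subseteq> U"
    using assms open_contains_ball by metis
  \<comment> \<open>Two displacements, each shorter than \<open>d\<close>, stay within
    \<open>min d1 d2\<close>.\<close>
  define d where "d = min d1 d2 / 2"
  have "d > 0" using d1 d2 by (simp add: d_def)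
  have near: "x + s *\<^sub>R axis i 1 + t *\<^sub>R axis j 1 \<in> U"
      "dist (x + s *\<^sub>R axis i 1 + t *\<^sub>R axis j 1) x < d1"
    if "0 \<le> s" "s < d" "0 \<le> t" "t < d" for s t
  proof -
    have "dist (x + s *\<^sub>R axis i 1 + t *\<^sub>R axis j 1) x \<le> norm (s *\<^sub>R axis i (1::real)) + norm (t *\<^sub>R axis j (1::real))"
      by (simp add: dist_norm add.assoc norm_triangle_ineq del: norm_scaleR)
    also have "\<dots> < min d1 d2" using that by (simp add: d_def)
    finally show "x + s *\<^sub>R axis i 1 + t *\<^sub>R axis j 1 \<in> U"
      "dist (x + s *\<^sub>R axis i 1 + t *\<^sub>R axis j 1) x < d1"
      using d2 by (auto simp: dist_commute subset_iff)
  qed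
  have "\<bar>f (x + h *\<^sub>R axis i 1 + h *\<^sub>R axis j 1) - f (x + h *\<^sub>R axis i 1) - f (x + h *\<^sub>R axis j 1) + f x
      - h\<^sup>2 * ?g x\<bar> < e * h\<^sup>2" if h: "0 < h" "h < d" for h
  proof -
    let ?A = "\<lambda>s. f ((x + h *\<^sub>R axis j 1) + s *\<^sub>R axis i 1) - f (x + s *\<^sub>R axis i 1)"
    have "\<exists>s. 0 < s \<and> s < h \<and> ?A h - ?A 0 = (h - 0) *
       (pderiv_at i f ((x + h *\<^sub>R axis j 1) + s *\<^sub>R axis i 1) - pderiv_at i f (x + s *\<^sub>R axis i 1))"
    proof (rule MVT2)
      fix s assume s: "0 \<le> s" "s \<le> h"
      show "(?A has_real_derivative (pderiv_at i f ((x + h *\<^sub>R axis j 1) + s *\<^sub>R axis i 1) - pderiv_at i f (x + s *\<^sub>R axis i 1))) (at s)"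
        using near(1)[of s h] near(1)[of s 0] s h
        by (intro DERIV_diff has_real_derivative_along_axis[OF assms(2)]) (auto simp: add_ac)
    qed (use h in auto)
    then obtain s where s: "0 < s" "s < h" and As: "?A h - ?A 0 = h *
       (pderiv_at i f ((x + h *\<^sub>R axis j 1) + s *\<^sub>R axis i 1) - pderiv_at i f (x + s *\<^sub>R axis i 1))"
      by auto
    let ?B = "\<lambda>t. pderiv_at i f ((x + s *\<^sub>R axis i 1) + t *\<^sub>R axis j 1)"
    have "\<exists>t. 0 < t \<and> t < h \<and> ?B h - ?B 0 = (h - 0) * ?g ((x + s *\<^sub>R axis i 1) + t *\<^sub>R axis j 1)"
    proof (rule MVT2)
      fix t assume t: "0 \<le> t" "t \<le> h"
      show "(?B has_real_derivative ?g ((x + s *\<^sub>R axis i 1) + t *\<^sub>R axis j 1)) (at t)"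
        using near(1)[of s t] s t h
        by (intro has_real_derivative_along_axis[OF smooth_on_pderiv[OF assms(2)]]) auto
    qed (use h in auto)
    then obtain t where t: "0 < t" "t < h" and Bt: "?B h - ?B 0 = h * ?g ((x + s *\<^sub>R axis i 1) + t *\<^sub>R axis j 1)"
      by auto
    have "\<bar>?g ((x + s *\<^sub>R axis i 1) + t *\<^sub>R axis j 1) - ?g x\<bar> < e"
      using d1(2) near(2)[of s t] s t h by (simp add: dist_real_def)
    moreover have "f (x + h *\<^sub>R axis i 1 + h *\<^sub>R axis j 1) - f (x + h *\<^sub>R axis i 1) - f (x + h *\<^sub>R axis j 1) + f x
       = h\<^sup>2 * ?g ((x + s *\<^sub>R axis i 1) + t *\<^sub>R axis j 1)"
      using As Bt by (simp add: add_ac power2_eq_square)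
    ultimately show ?thesis
      using h by (simp add: right_diff_distrib[symmetric] abs_mult mult.commute)
  qed
  with \<open>d > 0\<close> show ?thesis using that by blast
qed

text \<open>The second difference is symmetric in i and j, and both mixed derivatives are limits of
  its quotient by h^2.\<close>

lemma pderiv_at_commute:
  fixes f :: "real^'N \<Rightarrow> real"
  assumes "open U" "smooth_on U f" "x \<in> U"
  shows "pderiv_at i (pderiv_at j f) x = pderiv_at j (pderiv_at i f) x"
proof (rule ccontr)
  assume ne: "\<not> ?thesis"
  \<comment> \<open>Half the supposed gap: the two errors then add up to strictly less than the gap
    times h^2.\<close>
  define e where "e = \<bar>pderiv_at i (pderiv_at j f) x - pderiv_at j (pderiv_at i f) x\<bar> / 2"
  have e: "e > 0" using ne by (simp add: e_def)
  let ?D = "\<lambda>h. f (x + h *\<^sub>R axis i 1 + h *\<^sub>R axis j 1) - f (x + h *\<^sub>R axis i 1) - f (x + h *\<^sub>R axis j 1) + f x"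
  obtain d1 where d1: "d1 > 0" "\<And>h. 0 < h \<Longrightarrow> h < d1 \<Longrightarrow>
     \<bar>?D h - h\<^sup>2 * pderiv_at j (pderiv_at i f) x\<bar> < e * h\<^sup>2"
    using mixed_difference_quotient[OF assms e, of i j] by metis
  obtain d2 where d2: "d2 > 0" "\<And>h. 0 < h \<Longrightarrow> h < d2 \<Longrightarrow>
     \<bar>?D h - h\<^sup>2 * pderiv_at i (pderiv_at j f) x\<bar> < e * h\<^sup>2"
    using mixed_difference_quotient[OF assms e, of j i] by (simp add: add_ac diff_diff_eq) metis
  define h where "h = min d1 d2 / 2"
  have h: "h > 0" "h < d1" "h < d2" using d1 d2 by (auto simp: h_def)
  have "\<bar>h\<^sup>2 * pderiv_at i (pderiv_at j f) x - h\<^sup>2 * pderiv_at j (pderiv_at i f) x\<bar> < 2 * (e * h\<^sup>2)"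
    using d1(2)[OF h(1,2)] d2(2)[OF h(1,3)] by linarith
  also have "\<dots> = h\<^sup>2 * \<bar>pderiv_at i (pderiv_at j f) x - pderiv_at j (pderiv_at i f) x\<bar>"
    by (simp add: e_def)
  finally show False using h by (simp add: right_diff_distrib[symmetric] abs_mult)
qed

lemma hess_sym_mats:
  assumes "open U" "smooth_on U f" "x \<in> U"
  shows "hess f x \<in> sym_mats"
  using pderiv_at_commute[OF assms] by (simp add: sym_mats_def transpose_def vec_eq_iff)

text \<open>The right-hand side is what differentiating grad f . w along the line through x in
  direction w produces. The row index of \<open>hess\<close> is the outer derivative, hence the use
  of symmetry.\<close>

lemma inner_hess:
  "w \<bullet> (hess f x *v w) = (\<Sum>i\<in>UNIV. w $ i * (grad (pderiv_at i f) x \<bullet> w))" if "open U" "smooth_on U f" "x \<in> U"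
  by (simp add: inner_vec_def matrix_vector_mult_def pderiv_at_commute[OF that])

text \<open>Along a direction with negative second derivative the first derivative, zero at the
  minimum, becomes negative immediately to the right, so the mean value theorem yields a smaller
  value nearby.\<close>

lemma hess_nonneg_at_local_min:
  fixes d :: "real^'N \<Rightarrow> real"
  assumes U: "open U" "smooth_on U d" "x \<in> U" and le: "\<And>y. y \<in> U \<Longrightarrow> d x \<le> d y"
  shows "0 \<le> w \<bullet> (hess d x *v w)"
proof (rule ccontr)
  assume neg: "\<not> ?thesis"
  let ?P = "\<lambda>s. x + s *\<^sub>R w"
  let ?D = "\<lambda>s. grad d (?P s) \<bullet> w"
  have "continuous_on UNIV ?P" by (intro continuous_intros)
  then have "open (?P -` U)" using U(1) by (rule open_vimage[rotated])
  then obtain r where r: "r > 0" "ball 0 r \<subseteq> ?P -` U"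
    using U(3) by (metis (no_types, lifting) add.right_neutral open_contains_ball scaleR_zero_left vimageI2 vimage_eq)
  have inU: "?P s \<in> U" if "\<bar>s\<bar> < r" for s
    using r that by (auto simp: subset_iff)
  have d1: "((\<lambda>s. d (?P s)) has_real_derivative ?D s) (at s)" if "\<bar>s\<bar> < r" for s
    by (rule has_real_derivative_along_line[OF U(2)]) (rule inU[OF that])
  have D0: "?D 0 = 0"
    using DERIV_local_min[OF d1[of 0] r(1)] r(1) le inU by auto
  have "((\<lambda>s. \<Sum>i\<in>UNIV. w $ i * pderiv_at i d (?P s)) has_real_derivative
     (\<Sum>i\<in>UNIV. w $ i * (grad (pderiv_at i d) (?P 0) \<bullet> w))) (at 0)"
    by (intro DERIV_sum DERIV_cmult has_real_derivative_along_line[OF smooth_on_pderiv[OF U(2)]] inU)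
      (use r in auto)
  then have "(?D has_real_derivative (w \<bullet> (hess d x *v w))) (at 0)"
    by (simp add: inner_hess[OF U]) (simp add: inner_vec_def mult.commute)
  from DERIV_neg_dec_right[OF this] neg D0
  obtain e where e: "e > 0" "\<And>h. 0 < h \<Longrightarrow> h < e \<Longrightarrow> ?D h < 0" by auto
  define h where "h = min e r / 2"
  have h: "0 < h" "h < e" "h < r" using e r by (auto simp: h_def)
  have "\<exists>z. 0 < z \<and> z < h \<and> d (?P h) - d (?P 0) = (h - 0) * ?D z"
    by (rule MVT2[OF h(1)], rule d1) (use h in auto)
  then obtain z where z: "0 < z" "z < h" "d (?P h) - d x = h * ?D z" by auto
  have "h * ?D z < 0" using z e(2)[of z] h by (simp add: mult_pos_neg)
  moreover have "d x \<le> d (?P h)" using le inU[of h] h by simp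
  ultimately show False using z by simp
qed

section \<open>Pullback along coordinate projections\<close>

text \<open>Parametrized by an index map so that both projections of the product,
  \<open>sel Inl\<close> and \<open>sel Inr\<close>, are covered by the same calculus.\<close>

definition sel :: "('k \<Rightarrow> 'N) \<Rightarrow> real^'N \<Rightarrow> real^'k" where
  "sel \<iota> z = (\<chi> k. z $ \<iota> k)"

lemma sel_nth [simp]: "sel \<iota> z $ k = z $ \<iota> k"
  by (simp add: sel_def)

lemma linear_sel: "linear (sel \<iota> :: real^'N \<Rightarrow> real^'k)"
  by (rule linearI) (auto simp: vec_eq_iff)

lemma continuous_on_sel [continuous_intros]:
  "continuous_on S f \<Longrightarrow> continuous_on S (\<lambda>x. sel \<iota> (f x))"
  unfolding sel_def by (intro continuous_intros)

lemma sel_axis: "inj \<iota> \<Longrightarrow> sel \<iota> (axis (\<iota> i) (1::real)) = axis i 1"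
  by (auto simp: vec_eq_iff axis_def inj_eq)

lemma sel_axis_notin: "k \<notin> range \<iota> \<Longrightarrow> sel \<iota> (axis k (1::real)) = 0"
  by (auto simp: vec_eq_iff axis_def)

lemma has_derivative_sel:
  assumes "Ck_on (Suc k) U v" "sel \<iota> z \<in> U"
  shows "((\<lambda>z. v (sel \<iota> z)) has_derivative (\<lambda>h. grad v (sel \<iota> z) \<bullet> sel \<iota> h)) (at z)"
  using has_derivative_compose[OF linear_imp_has_derivative[OF linear_sel] has_derivative_grad_on[OF assms]] .

lemma pderiv_at_sel:
  assumes "smooth_on U v" "sel \<iota> z \<in> U" "inj \<iota>"
  shows "pderiv_at (\<iota> i) (\<lambda>z. v (sel \<iota> z)) z = pderiv_at i v (sel \<iota> z)"
  and "k \<notin> range \<iota> \<Longrightarrow> pderiv_at k (\<lambda>z. v (sel \<iota> z)) z = 0"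
proof -
  have D: "((\<lambda>z. v (sel \<iota> z)) has_derivative (\<lambda>h. grad v (sel \<iota> z) \<bullet> sel \<iota> h)) (at z)"
    using assms has_derivative_sel smooth_on_def by blast
  show "pderiv_at (\<iota> i) (\<lambda>z. v (sel \<iota> z)) z = pderiv_at i v (sel \<iota> z)"
    by (simp add: pderiv_at_eq[OF D] sel_axis assms)
  show "k \<notin> range \<iota> \<Longrightarrow> pderiv_at k (\<lambda>z. v (sel \<iota> z)) z = 0"
    by (simp add: pderiv_at_eq[OF D] sel_axis_notin)
qed

lemma open_vimage_sel: "open U \<Longrightarrow> open (sel \<iota> -` U)"
  by (intro open_vimage continuous_intros)

lemma Ck_on_sel:
  assumes "open U" "inj \<iota>"
  shows "Ck_on k U v \<Longrightarrow> Ck_on k (sel \<iota> -` U) (\<lambda>z. v (sel \<iota> z))"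
proof (induction k arbitrary: v)
  case 0
  then show ?case by (auto intro!: continuous_on_compose2[of U v] continuous_intros)
next
  case (Suc k)
  note D = has_derivative_sel[OF Suc.prems]
  have "Ck_on k (sel \<iota> -` U) (pderiv_at j (\<lambda>z. v (sel \<iota> z)))" for j
  proof (cases "j \<in> range \<iota>")
    case True
    then obtain i where j: "j = \<iota> i" by blast
    show ?thesis
      by (rule Ck_on_cong[OF open_vimage_sel[OF assms(1)], of \<iota> "\<lambda>z. pderiv_at i v (sel \<iota> z)"])
        (use Suc in \<open>auto simp: pderiv_at_eq[OF D] sel_axis assms j\<close>)
  next
    case False
    show ?thesis
      by (rule Ck_on_cong[OF open_vimage_sel[OF assms(1)], of \<iota> "\<lambda>z. 0"])
        (auto simp: pderiv_at_eq[OF D] sel_axis_notin False Ck_on_const)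
  qed
  moreover have "(\<lambda>z. v (sel \<iota> z)) differentiable (at z)" if "z \<in> sel \<iota> -` U" for z
    using D that by (auto simp: differentiable_def)
  ultimately show ?case by simp
qed

lemma smooth_on_sel:
  "open U \<Longrightarrow> inj \<iota> \<Longrightarrow> smooth_on U v \<Longrightarrow> smooth_on (sel \<iota> -` U) (\<lambda>z. v (sel \<iota> z))"
  by (simp add: smooth_on_def Ck_on_sel)

lemma hess_sel:
  assumes "open U" "smooth_on U v" "sel \<iota> z \<in> U" "inj \<iota>"
  shows "hess (\<lambda>z. v (sel \<iota> z)) z $ \<iota> i $ \<iota> j = hess v (sel \<iota> z) $ i $ j"
    and "k \<notin> range \<iota> \<Longrightarrow> hess (\<lambda>z. v (sel \<iota> z)) z $ k $ l = 0"
    and "l \<notin> range \<iota> \<Longrightarrow> hess (\<lambda>z. v (sel \<iota> z)) z $ k $ l = 0"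
proof -
  note W = open_vimage_sel[OF assms(1)]
  have "pderiv_at (\<iota> i) (pderiv_at (\<iota> j) (\<lambda>z. v (sel \<iota> z))) z
     = pderiv_at (\<iota> i) (\<lambda>z. pderiv_at j v (sel \<iota> z)) z"
    by (rule pderiv_at_cong[OF W[of \<iota>]]) (use assms pderiv_at_sel(1) in auto)
  then show "hess (\<lambda>z. v (sel \<iota> z)) z $ \<iota> i $ \<iota> j = hess v (sel \<iota> z) $ i $ j"
    by (simp add: pderiv_at_sel(1)[OF smooth_on_pderiv[OF assms(2)] assms(3,4)])
  \<comment> \<open>The column case is direct, because the inner derivative vanishes near the point;
    the row case then follows by symmetry.\<close>
  have *: "hess (\<lambda>z. v (sel \<iota> z)) z $ k $ l = 0" if l: "l \<notin> range \<iota>" for k l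
  proof -
    have "pderiv_at k (pderiv_at l (\<lambda>z. v (sel \<iota> z))) z = pderiv_at k (\<lambda>z. 0) z"
      by (rule pderiv_at_cong[OF W[of \<iota>]]) (use assms pderiv_at_sel(2)[OF _ _ _ l] in auto)
    then show ?thesis by simp
  qed
  then show "l \<notin> range \<iota> \<Longrightarrow> hess (\<lambda>z. v (sel \<iota> z)) z $ k $ l = 0" .
  show "k \<notin> range \<iota> \<Longrightarrow> hess (\<lambda>z. v (sel \<iota> z)) z $ k $ l = 0"
    using *[of k l] pderiv_at_commute[OF W smooth_on_sel[OF assms(1,4,2)], of z k l] assms by simp
qed

section \<open>Matrices and sets stable under adding positive semidefinite ones\<close>

text \<open>The norm of a matrix is the Frobenius norm here, so Cauchy-Schwarz in each row
  suffices.\<close>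

lemma norm_matrix_vector_mult_le:
  fixes A :: "real^'n^'m"
  shows "norm (A *v x) \<le> norm A * norm x"
proof -
  have "norm ((A *v x) $ i) \<le> norm (A $ i) * norm x" for i
    using Cauchy_Schwarz_ineq2[of "A $ i" x] by (simp add: matrix_vector_mul_component)
  then have "norm (A *v x) \<le> L2_set (\<lambda>i. norm (A $ i) * norm x) UNIV"
    unfolding norm_vec_def[of "A *v x"] by (intro L2_set_mono) auto
  also have "\<dots> = norm A * norm x"
    by (simp add: L2_set_left_distrib[symmetric] norm_vec_def[of A])
  finally show ?thesis .
qed

text \<open>The bridge from metric to order: closeness of symmetric matrices becomes an inequality
  up to a multiple of the identity, and monotone sets only understand the latter.\<close>

lemma psd_mats_add_norm:
  fixes A :: "real^'n^'n"
  assumes "A \<in> sym_mats" "norm A \<le> d"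
  shows "A + d *\<^sub>R mat 1 \<in> psd_mats"
proof -
  have "0 \<le> x \<bullet> ((A + d *\<^sub>R mat 1) *v x)" for x
  proof -
    have "\<bar>x \<bullet> (A *v x)\<bar> \<le> norm x * (norm A * norm x)"
      by (meson Cauchy_Schwarz_ineq2 norm_matrix_vector_mult_le mult_left_mono norm_ge_zero order_trans)
    also have "\<dots> \<le> norm x * (d * norm x)"
      using assms by (intro mult_left_mono mult_right_mono) auto
    also have "\<dots> = d * (x \<bullet> x)"
      by (simp add: dot_square_norm power2_eq_square)
    finally show ?thesis
      by (simp add: matrix_vector_mult_add_rdistrib inner_add_right scaleR_matrix_vector_assoc[symmetric])
  qed
  then show ?thesis
    using assms by (simp add: psd_mats_def sym_mats_add sym_mats_scaleR sym_mats_mat)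
qed

lemma psd_mats_scaleR: "A \<in> psd_mats \<Longrightarrow> c \<ge> 0 \<Longrightarrow> c *\<^sub>R A \<in> psd_mats"
  by (simp add: psd_mats_def sym_mats_scaleR scaleR_matrix_vector_assoc[symmetric])

text \<open>The order-theoretic part of \<open>dirichlet_set\<close>, in a form that passes to
  \<open>sym_interior\<close> and \<open>dual_set\<close>.\<close>

definition psd_monotone :: "(real^'n^'n) set \<Rightarrow> bool" where
  "psd_monotone G \<longleftrightarrow> G \<subseteq> sym_mats \<and> (\<forall>A\<in>G. \<forall>P\<in>psd_mats. A + P \<in> G)"

lemma dirichlet_set_psd_monotone: "dirichlet_set G \<Longrightarrow> psd_monotone G"
  by (auto simp: dirichlet_set_def psd_monotone_def)

lemma psd_monotoneD: "psd_monotone G \<Longrightarrow> A \<in> G \<Longrightarrow> B - A \<in> psd_mats \<Longrightarrow> B \<in> G"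
  unfolding psd_monotone_def by (metis add.commute diff_add_cancel)

lemma sym_interior_subset: "sym_interior G \<subseteq> G"
  by (simp add: sym_interior_def interior_of_subset)

lemma sym_interiorD:
  assumes "A \<in> sym_interior G"
  obtains d where "d > 0" "A - d *\<^sub>R mat 1 \<in> G"
proof -
  from assms obtain T where T: "openin (top_of_set sym_mats) T" "A \<in> T" "T \<subseteq> G"
    by (auto simp: sym_interior_def interior_of_def)
  then obtain e where e: "e > 0" "ball A e \<inter> sym_mats \<subseteq> T"
    unfolding openin_contains_ball by blast
  \<comment> \<open>The summand 1 makes \<open>N\<close> visibly positive, so that dividing by it is
    harmless.\<close>
  define N where "N = norm (mat 1 :: real^'a^'a) + 1"
  have N: "N > 0" by (simp add: N_def add_nonneg_pos)
  define d where "d = e / (2 * N)"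
  have d: "d > 0" using e N by (simp add: d_def)
  have "norm (d *\<^sub>R (mat 1 :: real^'a^'a)) \<le> d * N"
    using d by (simp add: N_def)
  also have "\<dots> < e" using e N by (simp add: d_def)
  finally have "norm (d *\<^sub>R (mat 1 :: real^'a^'a)) < e" .
  moreover have "A \<in> sym_mats" using T(1,2) openin_subset by fastforce
  ultimately have "A - d *\<^sub>R mat 1 \<in> ball A e \<inter> sym_mats"
    by (auto simp: dist_norm sym_mats_diff sym_mats_scaleR sym_mats_mat)
  with e T d that show ?thesis by blast
qed

text \<open>If A - d I lies in the set, then every symmetric B within d of A exceeds A - d I by a
  positive semidefinite matrix. Together with \<open>sym_interiorD\<close> this makes interior
  membership an order condition.\<close>

lemma sym_interiorI:
  fixes G :: "(real^'n^'n) set"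
  assumes "psd_monotone G" "A - d *\<^sub>R mat 1 \<in> G" "d > 0"
  shows "A \<in> sym_interior G"
proof -
  have "A - d *\<^sub>R mat 1 + d *\<^sub>R mat 1 \<in> sym_mats"
    using assms by (intro sym_mats_add sym_mats_scaleR sym_mats_mat) (auto simp: psd_monotone_def)
  then have A: "A \<in> sym_mats" by simp
  have "B \<in> G" if "B \<in> sym_mats" "dist A B < d" for B
  proof (rule psd_monotoneD[OF assms(1,2)])
    have "(B - A) + d *\<^sub>R mat 1 \<in> psd_mats"
      using that A by (intro psd_mats_add_norm sym_mats_diff) (auto simp: dist_norm norm_minus_commute)
    then show "B - (A - d *\<^sub>R mat 1) \<in> psd_mats" by (simp add: algebra_simps)
  qed
  moreover have "openin (top_of_set sym_mats) (sym_mats \<inter> ball A d)"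
    by (simp add: openin_open_Int)
  ultimately show ?thesis
    unfolding sym_interior_def interior_of_def using A \<open>d > 0\<close>
    by (auto intro!: exI[of _ "sym_mats \<inter> ball A d"])
qed

lemma sym_interior_add:
  assumes "psd_monotone G" "A \<in> G" "d > 0"
  shows "A + d *\<^sub>R mat 1 \<in> sym_interior G"
  by (rule sym_interiorI[OF assms(1) _ assms(3)]) (simp add: assms)

lemma psd_monotone_sym_interior:
  assumes "psd_monotone G"
  shows "psd_monotone (sym_interior G)"
  unfolding psd_monotone_def
proof safe
  show "A \<in> sym_mats" if "A \<in> sym_interior G" for A
    using that sym_interior_subset assms by (auto simp: psd_monotone_def)
  fix A P :: "real^'a^'a" assume "A \<in> sym_interior G" "P \<in> psd_mats"
  then obtain d where d: "d > 0" "A - d *\<^sub>R mat 1 \<in> G" using sym_interiorD by blast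
  have "A - d *\<^sub>R mat 1 + P \<in> G"
    using assms d \<open>P \<in> psd_mats\<close> by (auto simp: psd_monotone_def)
  then show "A + P \<in> sym_interior G"
    using assms d by (intro sym_interiorI[of G _ d]) (auto simp: algebra_simps)
qed

lemma psd_monotone_dual_set:
  assumes "psd_monotone G"
  shows "psd_monotone (dual_set G)"
  unfolding psd_monotone_def
proof safe
  show "A \<in> sym_mats" if "A \<in> dual_set G" for A
    using that by (auto simp: dual_set_def)
  fix A P :: "real^'a^'a" assume A: "A \<in> dual_set G" and P: "P \<in> psd_mats"
  have "- (A + P) \<notin> sym_interior G"
  proof
    assume "- (A + P) \<in> sym_interior G"
    then have "- (A + P) + P \<in> sym_interior G"
      using psd_monotone_sym_interior[OF assms] P unfolding psd_monotone_def by blast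
    then have "- A \<in> sym_interior G" by simp
    with A show False unfolding dual_set_def by force
  qed
  moreover have "A + P \<in> sym_mats"
    using A P by (auto simp: dual_set_def psd_mats_def sym_mats_add)
  ultimately show "A + P \<in> dual_set G"
    unfolding dual_set_def by (metis DiffI imageE minus_minus)
qed

text \<open>This turns a barrier for the dual into the strict condition that comparison needs. If -A
  were in \<open>G\<close>, then -(A - d I) would be interior to \<open>G\<close>, while A - d I
  still belongs to the dual.\<close>

lemma sym_interior_dual_set:
  assumes "psd_monotone G" "A \<in> sym_interior (dual_set G)"
  shows "- A \<notin> G"
proof
  assume "- A \<in> G"
  obtain d where d: "d > 0" "A - d *\<^sub>R mat 1 \<in> dual_set G" using sym_interiorD assms by blast
  have "- A + d *\<^sub>R mat 1 \<in> sym_interior G"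
    using sym_interior_add assms(1) \<open>- A \<in> G\<close> d by blast
  with d(2) show False unfolding dual_set_def by force
qed

text \<open>The ray set is a closure, so A - d I is only approximated by some A' that generates a
  ray in \<open>G\<close>. Half of the margin d pays for the approximation, the other half
  remains.\<close>

lemma sym_interior_ray_set:
  assumes "psd_monotone G" "A \<in> sym_interior (ray_set G)"
  obtains d t\<^sub>0 where "d > 0" "t\<^sub>0 > 0" "\<And>t. t \<ge> t\<^sub>0 \<Longrightarrow> t *\<^sub>R (A - d *\<^sub>R mat 1) \<in> G"
proof -
  obtain d where d: "d > 0" "A - d *\<^sub>R mat 1 \<in> ray_set G" using sym_interiorD assms by blast
  then obtain A' where A': "A' \<in> ray_from G 0" "dist A' (A - d *\<^sub>R mat 1) < d / 2"
    unfolding ray_set_def closure_approachable by (metis half_gt_zero)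
  then obtain s where s: "A' \<in> sym_mats" "\<And>t. t \<ge> s \<Longrightarrow> t *\<^sub>R A' \<in> G"
    by (auto simp: ray_from_def)
  have A: "A \<in> sym_mats"
    using assms(2) unfolding sym_interior_def interior_of_def using openin_subset by fastforce
  have P: "(A - d *\<^sub>R mat 1 - A') + (d / 2) *\<^sub>R mat 1 \<in> psd_mats"
    using A A' s by (intro psd_mats_add_norm sym_mats_diff sym_mats_scaleR sym_mats_mat)
      (auto simp: dist_norm norm_minus_commute)
  have "t *\<^sub>R (A - (d / 2) *\<^sub>R mat 1) \<in> G" if t: "t \<ge> max s 1" for t
  proof (rule psd_monotoneD[OF assms(1)])
    show "t *\<^sub>R A' \<in> G" using s t by simp
    have "t *\<^sub>R ((A - d *\<^sub>R mat 1 - A') + (d / 2) *\<^sub>R mat 1) \<in> psd_mats"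
      using t by (intro psd_mats_scaleR P) auto
    also have "t *\<^sub>R ((A - d *\<^sub>R mat 1 - A') + (d / 2) *\<^sub>R mat 1) = t *\<^sub>R (A - (d / 2) *\<^sub>R mat 1) - t *\<^sub>R A'"
      by (simp add: vec_eq_iff field_simps)
    finally show "t *\<^sub>R (A - (d / 2) *\<^sub>R mat 1) - t *\<^sub>R A' \<in> psd_mats" .
  qed
  then show ?thesis using that[of "d/2" "max s 1"] d by auto
qed

section \<open>Block structure of the product space and of \<open>star_psd\<close>\<close>

lemma vjoin_nth [simp]: "vjoin x y $ Inl i = x $ i" "vjoin x y $ Inr j = y $ j"
  by (simp_all add: vjoin_def)

lemma sel_vjoin [simp]: "sel Inl (vjoin x y) = x" "sel Inr (vjoin x y) = y"
  by (simp_all add: vec_eq_iff)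

lemma vec_eq_sum_index_iff:
  "(z :: real^('n::finite+'m::finite)) = w \<longleftrightarrow> (\<forall>i. z $ Inl i = w $ Inl i) \<and> (\<forall>j. z $ Inr j = w $ Inr j)"
  unfolding vec_eq_iff by (metis sum.exhaust)

lemma vjoin_sel [simp]: "vjoin (sel Inl z) (sel Inr z) = z"
  by (simp add: vec_eq_sum_index_iff)

lemma cyl_iff: "z \<in> cyl S \<longleftrightarrow> sel Inl z \<in> S"
  by (auto simp: cyl_def) (metis vjoin_sel)

lemma cyl_eq: "cyl S = sel Inl -` S"
  by (auto simp: cyl_iff)

lemma sum_over_sum_type:
  fixes f :: "'n::finite + 'm::finite \<Rightarrow> real"
  shows "(\<Sum>k\<in>UNIV. f k) = (\<Sum>i\<in>UNIV. f (Inl i)) + (\<Sum>j\<in>UNIV. f (Inr j))"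
  unfolding UNIV_Plus_UNIV[symmetric] by (subst sum.Plus) auto

lemma inner_sum_type:
  fixes z w :: "real^('n::finite+'m::finite)"
  shows "z \<bullet> w = sel Inl z \<bullet> sel Inl w + sel Inr z \<bullet> sel Inr w"
  by (simp add: inner_vec_def sum_over_sum_type)

lemma sel_matrix_vector_mult:
  fixes A :: "real^('n::finite+'m::finite)^('n::finite+'m::finite)"
  shows "sel Inl (A *v z) = block_B A *v sel Inl z + block_C A *v sel Inr z"
    and "A \<in> sym_mats \<Longrightarrow> sel Inr (A *v z) = transpose (block_C A) *v sel Inl z + block_D A *v sel Inr z"
proof -
  show "sel Inl (A *v z) = block_B A *v sel Inl z + block_C A *v sel Inr z"
    by (simp add: vec_eq_iff matrix_vector_mult_def sum_over_sum_type block_B_def block_C_def)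
  assume "A \<in> sym_mats"
  then have "A $ k $ l = A $ l $ k" for k l
    by (auto simp: sym_mats_def transpose_def vec_eq_iff)
  then show "sel Inr (A *v z) = transpose (block_C A) *v sel Inl z + block_D A *v sel Inr z"
    by (simp add: vec_eq_iff matrix_vector_mult_def sum_over_sum_type block_D_def block_C_def transpose_def)
qed

text \<open>The geometric meaning of the block formula: the quadratic form is restricted to the
  graph of \<Gamma>. This replaces block computations later on.\<close>

lemma inner_slice:
  assumes "A \<in> sym_mats"
  shows "a \<bullet> (slice \<Gamma> A *v a) = vjoin a (\<Gamma> *v a) \<bullet> (A *v vjoin a (\<Gamma> *v a))"
proof -
  have "a \<bullet> (transpose \<Gamma> *v c) = (\<Gamma> *v a) \<bullet> c" for c
    by (metis dot_lmul_matrix vector_transpose_matrix transpose_transpose inner_commute)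
  then show ?thesis
    using assms by (simp add: slice_def inner_sum_type sel_matrix_vector_mult inner_add_right
        matrix_vector_mult_add_rdistrib matrix_vector_mul_assoc[symmetric] matrix_vector_right_distrib)
qed

lemma slice_0: "slice 0 A = block_B A"
  by (simp add: slice_def vec_eq_iff matrix_matrix_mult_def transpose_def)

lemma inner_block_D:
  assumes "A \<in> sym_mats"
  shows "b \<bullet> (block_D A *v b) = vjoin 0 b \<bullet> (A *v vjoin 0 b)"
  using assms by (simp add: inner_sum_type sel_matrix_vector_mult matrix_vector_mult_0_right)

lemma block_sym_mats:
  assumes "A \<in> sym_mats"
  shows "block_B A \<in> sym_mats" "block_D A \<in> sym_mats" "slice \<Gamma> A \<in> sym_mats"
proof -
  have "A $ k $ l = A $ l $ k" for k l
    using assms by (auto simp: sym_mats_def transpose_def vec_eq_iff)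
  then show B: "block_B A \<in> sym_mats" and D: "block_D A \<in> sym_mats"
    by (auto simp: sym_mats_def transpose_def vec_eq_iff block_B_def block_D_def)
  have "block_C A ** \<Gamma> + transpose \<Gamma> ** transpose (block_C A) \<in> sym_mats"
    by (simp add: sym_mats_def vec_eq_iff transpose_def matrix_matrix_mult_def mult.commute add.commute)
  moreover have "transpose \<Gamma> ** block_D A ** \<Gamma> \<in> sym_mats"
    using D by (simp add: sym_mats_def matrix_transpose_mul matrix_mul_assoc)
  ultimately show "slice \<Gamma> A \<in> sym_mats"
    using B sym_mats_add unfolding slice_def by (metis add.assoc)
qed

text \<open>The lower bound is the form of \<open>H\<close> extended by zero in the last
  coordinates. On a graph vector it reads a . H a whatever \<Gamma> is, and on vectors (0, b) it
  reads 0.\<close>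

lemma star_psdI:
  assumes F: "psd_monotone F" "H \<in> F" and A: "A \<in> sym_mats"
    and le: "\<And>w. sel Inl w \<bullet> (H *v sel Inl w) \<le> w \<bullet> (A *v w)"
  shows "A \<in> star_psd F"
proof -
  have H: "H \<in> sym_mats" using F by (auto simp: psd_monotone_def)
  have "block_D A \<in> psd_mats"
    using le[of "vjoin 0 b" for b] A block_sym_mats(2)[OF A]
    by (simp add: psd_mats_def inner_block_D)
  moreover have "slice \<Gamma> A \<in> F" for \<Gamma>
  proof (rule psd_monotoneD[OF F])
    show "slice \<Gamma> A - H \<in> psd_mats"
      using le[of "vjoin a (\<Gamma> *v a)" for a] A block_sym_mats(3)[OF A] H
      by (simp add: psd_mats_def sym_mats_diff inner_slice inner_diff_right matrix_vector_mult_diff_rdistrib)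
  qed
  ultimately show ?thesis using A by (simp add: star_psd_def)
qed

lemma closed_sym_mats: "closed (sym_mats :: (real^'n^'n) set)"
  unfolding sym_mats_def transpose_def by (intro closed_Collect_eq continuous_intros)

lemma closed_psd_mats: "closed (psd_mats :: (real^'n^'n) set)"
proof -
  have eq: "(psd_mats :: (real^'n^'n) set) = sym_mats \<inter> (\<Inter>x. {A. 0 \<le> x \<bullet> (A *v x)})"
    by (auto simp: psd_mats_def)
  have "closed {A :: real^'n^'n. 0 \<le> x \<bullet> (A *v x)}" for x
    unfolding matrix_vector_mult_def by (intro closed_Collect_le continuous_intros)
  then show ?thesis unfolding eq by (intro closed_Int closed_sym_mats closed_INT ballI)
qed

lemma closed_star_psd:
  assumes "closed F"
  shows "closed (star_psd F :: (real^('n::finite+'m::finite)^('n+'m)) set)"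
proof -
  have "continuous_on UNIV (\<lambda>A :: real^('n+'m)^('n+'m). slice \<Gamma> A)" for \<Gamma> :: "real^'n^'m"
    unfolding slice_def block_B_def block_C_def block_D_def matrix_matrix_mult_def transpose_def
    by (intro continuous_intros; simp; intro continuous_intros)
  moreover have "continuous_on UNIV (\<lambda>A :: real^('n+'m)^('n+'m). block_D A)"
    unfolding block_D_def by (intro continuous_intros)
  moreover have "star_psd F = sym_mats \<inter> (block_D -` psd_mats) \<inter> (\<Inter>\<Gamma>::real^'n^'m. slice \<Gamma> -` F)"
    by (auto simp: star_psd_def)
  ultimately show ?thesis
    using assms closed_sym_mats closed_psd_mats
    by (auto intro!: closed_Int closed_INT closed_vimage)
qed

section \<open>Upper semicontinuity and comparison\<close>

lemma usc_on_iff: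
  "usc_on Z f \<longleftrightarrow> (\<forall>z\<in>Z. f z < \<infinity>) \<and>
     (\<forall>z\<in>Z. \<forall>a::real. f z < ereal a \<longrightarrow> (\<exists>U. open U \<and> z \<in> U \<and> (\<forall>w\<in>U \<inter> Z. f w < ereal a)))"
proof -
  have "openin (top_of_set Z) {z \<in> Z. f z < ereal a} \<longleftrightarrow>
      (\<forall>z\<in>Z. f z < ereal a \<longrightarrow> (\<exists>U. open U \<and> z \<in> U \<and> (\<forall>w\<in>U \<inter> Z. f w < ereal a)))"
    (is "?L \<longleftrightarrow> ?R") for a
  proof
    assume ?L
    then obtain T where "open T" "{z \<in> Z. f z < ereal a} = Z \<inter> T"
      unfolding openin_open by blast
    then show ?R by blast
  next
    assume R: ?R
    have "\<exists>T. openin (top_of_set Z) T \<and> z \<in> T \<and> T \<subseteq> {z \<in> Z. f z < ereal a}"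
      if z: "z \<in> {z \<in> Z. f z < ereal a}" for z
    proof -
      obtain U where "open U" "z \<in> U" "\<forall>w\<in>U \<inter> Z. f w < ereal a" using R z by blast
      then show ?thesis using z by (intro exI[of _ "Z \<inter> U"]) (auto simp: openin_open_Int)
    qed
    then show ?L by (subst openin_subopen) blast
  qed
  then show ?thesis unfolding usc_on_def by blast
qed

lemma usc_on_subset:
  assumes "usc_on Z f" "Y \<subseteq> Z"
  shows "usc_on Y f"
  unfolding usc_on_iff
proof (intro conjI ballI allI impI)
  fix z assume z: "z \<in> Y"
  then show "f z < \<infinity>" using assms by (auto simp: usc_on_def)
  fix a assume "f z < ereal a"
  then obtain U where "open U" "z \<in> U" "\<forall>w\<in>U \<inter> Z. f w < ereal a"
    using assms z unfolding usc_on_iff by blast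
  then show "\<exists>U. open U \<and> z \<in> U \<and> (\<forall>w\<in>U \<inter> Y. f w < ereal a)"
    using assms(2) by (intro exI[of _ U]) auto
qed

lemma usc_on_cong: "(\<And>z. z \<in> Z \<Longrightarrow> f z = g z) \<Longrightarrow> usc_on Z f \<longleftrightarrow> usc_on Z g"
  unfolding usc_on_def by (simp cong: conj_cong)

lemma usc_on_add_continuous:
  assumes "usc_on Z f" "continuous_on Z q"
  shows "usc_on Z (\<lambda>z. f z + ereal (q z))"
  unfolding usc_on_iff
proof (intro conjI ballI allI impI)
  fix z assume z: "z \<in> Z"
  show "f z + ereal (q z) < \<infinity>" using assms z by (auto simp: usc_on_def)
  fix a assume a: "f z + ereal (q z) < ereal a"
  then have "f z < ereal (a - q z)" by (cases "f z") auto
  \<comment> \<open>The value \<open>b\<close> splits the inequality: f < b and q < a - b near z are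
    separately open conditions and add up to the goal.\<close>
  then obtain b where b: "f z < ereal b" "b < a - q z"
    using ereal_dense2 by (metis less_ereal.simps(1))
  then obtain U where U: "open U" "z \<in> U" "\<And>w. w \<in> U \<inter> Z \<Longrightarrow> f w < ereal b"
    using assms(1) z unfolding usc_on_iff by meson
  have "openin (top_of_set Z) (Z \<inter> q -` {..< a - b})"
    using assms(2) by (intro continuous_openin_preimage_gen) auto
  then obtain T where T: "open T" "Z \<inter> q -` {..< a - b} = Z \<inter> T"
    unfolding openin_open by blast
  have "f w + ereal (q w) < ereal a" if "w \<in> (U \<inter> T) \<inter> Z" for w
  proof -
    have "f w < ereal b" "q w < a - b" using that U T by blast+
    then show ?thesis by (cases "f w") auto
  qed
  moreover have "z \<in> T" using T z b by auto
  ultimately show "\<exists>U. open U \<and> z \<in> U \<and> (\<forall>w\<in>U \<inter> Z. f w + ereal (q w) < ereal a)"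
    using U T by (intro exI[of _ "U \<inter> T"]) auto
qed

lemma usc_on_continuous:
  assumes "continuous_on Z q"
  shows "usc_on Z (\<lambda>z. ereal (q z))"
proof -
  have "usc_on Z (\<lambda>_. 0)" unfolding usc_on_iff by (auto intro!: exI[of _ UNIV])
  from usc_on_add_continuous[OF this assms] show ?thesis by simp
qed

text \<open>Without a maximum the open sets where f < f y cover K. In a finite subcover, the centre
  with the largest value is not covered.\<close>

lemma usc_on_attains_max:
  assumes "usc_on K f" "compact K" "K \<noteq> {}"
  shows "\<exists>x\<in>K. \<forall>y\<in>K. f y \<le> f x"
proof (rule ccontr)
  assume "\<not> ?thesis"
  then have "\<forall>x\<in>K. \<exists>y\<in>K. f x < f y" by (simp add: not_le)
  then have ne: "K \<subseteq> (\<Union>y\<in>K. {z\<in>K. f z < f y})" by blast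
  have "openin (top_of_set K) {z\<in>K. f z < f y}" if "y \<in> K" for y
  proof (cases "f y")
    case (real r)
    then show ?thesis using assms(1) by (simp add: usc_on_def)
  next
    case PInf
    then show ?thesis using assms(1) that by (auto simp: usc_on_def)
  qed auto
  then obtain D where D: "D \<subseteq> K" "finite D" "K \<subseteq> (\<Union>y\<in>D. {z\<in>K. f z < f y})"
    using ne assms(2) unfolding compact_eq_openin_cover
    by (smt (verit) finite_subset_image image_iff)
  then have "D \<noteq> {}" using assms(3) by auto
  then have "Max (f ` D) \<in> f ` D" using D(2) by (intro Max_in) auto
  then obtain y where y: "y \<in> D" "f y = Max (f ` D)" by auto
  then obtain z where "z \<in> D" "f y < f z" using D(1,3) by blast
  moreover have "f z \<le> f y" using y(2) D(2) \<open>z \<in> D\<close> by simp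
  ultimately show False by simp
qed

text \<open>A local maximum of f - p becomes a touching point after adding a constant to
  \<open>p\<close>, which leaves the Hessian alone; the constant exists because \<open>f x\<close>
  is finite.\<close>

lemma subharmonic_on_touching:
  assumes sub: "subharmonic_on G Y f" and W: "open W" "W \<subseteq> Y" "x \<in> W" and p: "smooth_on W p"
    and le: "\<And>z. z \<in> W \<Longrightarrow> f z + ereal (- p z) \<le> f x + ereal (- p x)" and fx: "f x \<noteq> - \<infinity>"
  shows "hess p x \<in> G"
proof -
  have "f x < \<infinity>" using sub W by (auto simp: subharmonic_on_def usc_on_def)
  with fx obtain r where r: "f x = ereal r" by (cases "f x") auto
  define g where "g = (\<lambda>z. p z + (r - p x))"
  have "f z \<le> ereal (g z)" if "z \<in> W" for z
    using le[OF that] by (cases "f z") (auto simp: r g_def)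
  then have "test_function Y f x g"
    unfolding test_function_def using W p
    by (auto simp: g_def r intro!: exI[of _ W] smooth_on_add smooth_on_const)
  then have "hess g x \<in> G" using sub W by (auto simp: subharmonic_on_def)
  moreover have "hess g x = hess p x"
    unfolding g_def using hess_add[OF W(1) p smooth_on_const W(3)] by simp
  ultimately show ?thesis by simp
qed

section \<open>Separated sums on cylinders, and comparison with smooth functions\<close>

lemma open_cyl: "open U \<Longrightarrow> open (cyl U)"
  unfolding cyl_eq by (rule open_vimage_sel)

lemma
  fixes v :: "real^'n \<Rightarrow> real" and q :: "real^'m \<Rightarrow> real"
  assumes "open U" "smooth_on U v" "smooth_on UNIV q"
  shows smooth_on_split: "smooth_on (cyl U) (\<lambda>z. v (sel Inl z) + q (sel Inr z))"
    and hess_split: "sel Inl z \<in> U \<Longrightarrow> hess (\<lambda>z. v (sel Inl z) + q (sel Inr z)) z *v w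
      = vjoin (hess v (sel Inl z) *v sel Inl w) (hess q (sel Inr z) *v sel Inr w)"
    and block_B_hess_split:
      "sel Inl z \<in> U \<Longrightarrow> block_B (hess (\<lambda>z. v (sel Inl z) + q (sel Inr z)) z) = hess v (sel Inl z)"
proof -
  have v: "smooth_on (cyl U) (\<lambda>z. v (sel Inl z))"
    unfolding cyl_eq by (rule smooth_on_sel) (use assms in auto)
  have q: "smooth_on (cyl U) (\<lambda>z. q (sel Inr z))"
    using smooth_on_sel[OF open_UNIV inj_Inr assms(3)] by (rule smooth_on_subset) auto
  show "smooth_on (cyl U) (\<lambda>z. v (sel Inl z) + q (sel Inr z))"
    by (intro smooth_on_add open_cyl assms v q)
  assume z: "sel Inl z \<in> U"
  have H: "hess (\<lambda>z. v (sel Inl z) + q (sel Inr z)) z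
      = hess (\<lambda>z. v (sel Inl z)) z + hess (\<lambda>z. q (sel Inr z)) z"
    by (rule hess_add[OF open_cyl v q]) (use assms z in \<open>auto simp: cyl_iff\<close>)
  note S = hess_sel[OF assms(1,2) z inj_Inl] hess_sel[OF open_UNIV assms(3) UNIV_I inj_Inr]
  have ni: "Inr j \<notin> range Inl" "Inl i \<notin> range Inr" for i j by auto
  show "hess (\<lambda>z. v (sel Inl z) + q (sel Inr z)) z *v w
      = vjoin (hess v (sel Inl z) *v sel Inl w) (hess q (sel Inr z) *v sel Inr w)"
    unfolding H vec_eq_sum_index_iff
    by (simp add: matrix_vector_mult_def sum_over_sum_type S ni del: hess_nth)
  show "block_B (hess (\<lambda>z. v (sel Inl z) + q (sel Inr z)) z) = hess v (sel Inl z)"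
    unfolding H block_B_def vec_eq_iff by (simp add: S ni del: hess_nth)
qed

lemma continuous_on_vjoin [continuous_intros]:
  assumes "continuous_on S f" "continuous_on S g"
  shows "continuous_on S (\<lambda>p. vjoin (f p) (g p))"
proof -
  have "continuous_on S (\<lambda>p. case k of Inl i \<Rightarrow> f p $ i | Inr j \<Rightarrow> g p $ j)" for k
    using assms by (cases k) (auto intro!: continuous_intros)
  then show ?thesis unfolding vjoin_def by (intro continuous_on_vec_lambda)
qed

lemma compact_sel_Int:
  assumes "compact S" "compact T"
  shows "compact {z. sel Inl z \<in> S \<and> sel Inr z \<in> T}"
proof -
  have "{z. sel Inl z \<in> S \<and> sel Inr z \<in> T} = (\<lambda>p. vjoin (fst p) (snd p)) ` (S \<times> T)"
    by (auto simp: image_iff) (metis vjoin_sel)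
  then show ?thesis
    using assms by (auto intro!: compact_continuous_image continuous_intros compact_Times)
qed

text \<open>The maximum is sought on the compact cylinder over the ball of radius \<eta> about
  \<open>y\<^sub>1\<close>. A violation at \<open>y\<^sub>1\<close> survives the penalty, which
  vanishes there; the base boundary is excluded by \<open>bd\<close> and the lateral one by the size
  of the penalty, so the maximum is interior.\<close>

lemma comparison_at_slice:
  fixes \<zeta> :: "real^('n::finite+'m::finite) \<Rightarrow> ereal" and U :: "(real^'n) set" and y\<^sub>1 :: "real^'m"
  assumes U: "open U" "bounded U"
    and usc: "usc_on (cyl (closure U)) \<zeta>" and sub: "subharmonic_on (star_psd F) (cyl U) \<zeta>"
    and v: "smooth_on U v" "continuous_on (closure U) v" "\<And>x. x \<in> U \<Longrightarrow> - hess v x \<notin> F"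
    and eta: "\<eta> > 0"
    and bd: "\<And>x y. x \<in> frontier U \<Longrightarrow> y \<in> cball y\<^sub>1 \<eta> \<Longrightarrow> \<zeta> (vjoin x y) + ereal (v x) \<le> ereal c"
    and x: "x \<in> U"
  shows "\<zeta> (vjoin x y\<^sub>1) + ereal (v x) \<le> ereal c"
proof (rule ccontr)
  assume neg: "\<not> ?thesis"
  define K where "K = {z :: real^('n+'m). sel Inl z \<in> closure U \<and> sel Inr z \<in> cball y\<^sub>1 \<eta>}"
  have K: "compact K" "K \<subseteq> cyl (closure U)"
    using compact_sel_Int[of "closure U" "cball y\<^sub>1 \<eta>"] U(2) by (auto simp: K_def cyl_iff)
  have xK: "vjoin x y\<^sub>1 \<in> K" using x eta closure_subset by (auto simp: K_def)
  define f\<^sub>0 where "f\<^sub>0 = (\<lambda>z. \<zeta> z + ereal (v (sel Inl z)))"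
  have "continuous_on K (\<lambda>z. v (sel Inl z))"
    by (rule continuous_on_compose2[OF v(2)]) (auto simp: K_def intro!: continuous_intros)
  then have usc0: "usc_on K f\<^sub>0"
    unfolding f\<^sub>0_def by (intro usc_on_add_continuous usc_on_subset[OF usc K(2)])
  then obtain z\<^sub>0 where "z\<^sub>0 \<in> K" "\<And>z. z \<in> K \<Longrightarrow> f\<^sub>0 z \<le> f\<^sub>0 z\<^sub>0"
    using usc_on_attains_max[OF _ K(1)] xK by blast
  moreover obtain M where "f\<^sub>0 z\<^sub>0 \<le> ereal M"
    using usc0 \<open>z\<^sub>0 \<in> K\<close> by (cases "f\<^sub>0 z\<^sub>0") (auto simp: usc_on_def)
  ultimately have M: "\<And>z. z \<in> K \<Longrightarrow> f\<^sub>0 z \<le> ereal M" by (meson order_trans)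
  \<comment> \<open>On the lateral boundary the penalty equals k \<eta>^2, at least M - c, which
    brings the bound M down to c.\<close>
  define k where "k = \<bar>M - c\<bar> / \<eta>\<^sup>2"
  define Q where "Q = (\<lambda>y. k * ((y - y\<^sub>1) \<bullet> (y - y\<^sub>1)))"
  have k: "k \<ge> 0" "M - k * \<eta>\<^sup>2 \<le> c" using eta by (auto simp: k_def)
  define f\<^sub>1 where "f\<^sub>1 = (\<lambda>z. f\<^sub>0 z + ereal (- Q (sel Inr z)))"
  have "usc_on K f\<^sub>1"
    unfolding f\<^sub>1_def Q_def by (intro usc_on_add_continuous usc0 continuous_intros)
  then obtain z\<^sub>1 where z1: "z\<^sub>1 \<in> K" "\<And>z. z \<in> K \<Longrightarrow> f\<^sub>1 z \<le> f\<^sub>1 z\<^sub>1"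
    using usc_on_attains_max[OF _ K(1)] xK by blast
  have "f\<^sub>1 (vjoin x y\<^sub>1) = \<zeta> (vjoin x y\<^sub>1) + ereal (v x)"
    by (simp add: f\<^sub>1_def f\<^sub>0_def Q_def)
  with z1(2)[OF xK] neg have big: "f\<^sub>1 z\<^sub>1 > ereal c" by simp
  have Q: "Q y \<ge> 0" for y using k by (simp add: Q_def)
  have "sel Inl z\<^sub>1 \<notin> frontier U"
  proof
    assume "sel Inl z\<^sub>1 \<in> frontier U"
    then have "f\<^sub>0 z\<^sub>1 \<le> ereal c"
      using bd[of "sel Inl z\<^sub>1" "sel Inr z\<^sub>1"] z1(1) by (simp add: f\<^sub>0_def K_def)
    then have "f\<^sub>1 z\<^sub>1 \<le> ereal c"
      using Q[of "sel Inr z\<^sub>1"] unfolding f\<^sub>1_def by (cases "f\<^sub>0 z\<^sub>1") auto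
    with big show False by simp
  qed
  then have xU: "sel Inl z\<^sub>1 \<in> U"
    using z1(1) U(1) by (auto simp: K_def frontier_def interior_open)
  have "dist y\<^sub>1 (sel Inr z\<^sub>1) \<noteq> \<eta>"
  proof
    assume "dist y\<^sub>1 (sel Inr z\<^sub>1) = \<eta>"
    then have "Q (sel Inr z\<^sub>1) = k * \<eta>\<^sup>2"
      by (simp add: Q_def dot_square_norm dist_norm norm_minus_commute)
    then have "f\<^sub>1 z\<^sub>1 \<le> ereal c"
      using M[OF z1(1)] k(2) unfolding f\<^sub>1_def by (cases "f\<^sub>0 z\<^sub>1") auto
    with big show False by simp
  qed
  then have yB: "sel Inr z\<^sub>1 \<in> ball y\<^sub>1 \<eta>" using z1(1) by (auto simp: K_def)
  define p where "p = (\<lambda>z. (-1) * v (sel Inl z) + Q (sel Inr z))"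
  define W where "W = cyl U \<inter> sel Inr -` ball y\<^sub>1 \<eta>"
  have W: "open W" "W \<subseteq> cyl U" "z\<^sub>1 \<in> W" "W \<subseteq> K"
    using U(1) xU yB
    by (auto simp: W_def K_def cyl_iff
        intro!: open_Int open_cyl open_vimage_sel intro: closure_subset[THEN subsetD])
  have sm: "smooth_on U (\<lambda>x. (-1) * v x)" "smooth_on UNIV Q"
    unfolding Q_def
    by (rule smooth_on_cmult[OF U(1) v(1)], rule smooth_on_cmult[OF open_UNIV smooth_on_sqdist])
  have "smooth_on (cyl U) p"
    unfolding p_def by (rule smooth_on_split[OF U(1) sm])
  then have "smooth_on W p" using W smooth_on_subset by blast
  moreover have "\<zeta> z + ereal (- p z) = f\<^sub>1 z" for z
    unfolding f\<^sub>1_def f\<^sub>0_def p_def by (cases "\<zeta> z") auto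
  moreover have "\<zeta> z\<^sub>1 \<noteq> - \<infinity>"
    using big by (auto simp: f\<^sub>1_def f\<^sub>0_def)
  ultimately have "hess p z\<^sub>1 \<in> star_psd F"
    using W z1(2) by (intro subharmonic_on_touching[OF sub W(1,2,3)]) auto
  \<comment> \<open>\<Gamma> = 0 selects the first block, where the penalty contributes
    nothing.\<close>
  then have "block_B (hess p z\<^sub>1) \<in> F"
    unfolding star_psd_def by (metis (mono_tags, lifting) mem_Collect_eq slice_0)
  also have "block_B (hess p z\<^sub>1) = hess (\<lambda>x. (-1) * v x) (sel Inl z\<^sub>1)"
    unfolding p_def by (rule block_B_hess_split[OF U(1) sm xU])
  also have "\<dots> = - hess v (sel Inl z\<^sub>1)"
    using hess_cmult[OF U(1) v(1) xU, of "-1"] by simp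
  finally show False using v(3)[OF xU] by simp
qed

section \<open>Barriers at the boundary\<close>

lemma psd_mats_add: "A \<in> psd_mats \<Longrightarrow> B \<in> psd_mats \<Longrightarrow> A + B \<in> psd_mats"
  by (simp add: psd_mats_def sym_mats_add matrix_vector_mult_add_rdistrib inner_add_right)

lemma inner_sym_mats_commute: "A \<in> sym_mats \<Longrightarrow> x \<bullet> (A *v y) = (A *v x) \<bullet> y"
  using dot_lmul_matrix[of x A y] transpose_matrix_vector[of A x]
  unfolding sym_mats_def by simp

text \<open>Write v = a n + w with w orthogonal to n. The w-w term vanishes by assumption, Young's
  inequality splits the cross term between \<delta> |w|^2 and a multiple of a^2, and a^2 is
  controlled by the normal term.\<close>

lemma quadratic_form_nonneg_off_hyperplane:
  fixes E :: "real^'n^'n"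
  assumes E: "E \<in> sym_mats" and n: "n \<noteq> 0" and zero: "\<And>v. n \<bullet> v = 0 \<Longrightarrow> v \<bullet> (E *v v) = 0"
    and "\<delta> > 0"
  shows "\<exists>l\<ge>0. \<forall>v. 0 \<le> v \<bullet> (E *v v) + l * (n \<bullet> v)\<^sup>2 + \<delta> * (v \<bullet> v)"
proof (intro exI conjI allI)
  \<comment> \<open>\<open>q\<close> collects the coefficients of a^2: the normal-normal entry and
    the leftover of Young's inequality. Dividing by (n . n)^2 compensates for n . v = a (n .
    n).\<close>
  define q where "q = \<bar>n \<bullet> (E *v n)\<bar> + (norm (E *v n))\<^sup>2 / \<delta>"
  have nn: "n \<bullet> n > 0" using n by simp
  show "q / (n \<bullet> n)\<^sup>2 \<ge> 0" using \<open>\<delta> > 0\<close> by (simp add: q_def)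
  fix v
  define a where "a = (n \<bullet> v) / (n \<bullet> n)"
  define w where "w = v - a *\<^sub>R n"
  have nv: "n \<bullet> v = a * (n \<bullet> n)" using nn by (simp add: a_def)
  have nw: "n \<bullet> w = 0" by (simp add: w_def inner_diff_right nv)
  have v: "v = a *\<^sub>R n + w" by (simp add: w_def)
  have "v \<bullet> (E *v v) = a\<^sup>2 * (n \<bullet> (E *v n)) + 2 * a * ((E *v n) \<bullet> w) + w \<bullet> (E *v w)"
    unfolding v using inner_sym_mats_commute[OF E, of n w]
    by (simp add: matrix_vector_right_distrib matrix_vector_mult_scaleR inner_add_left inner_add_right
        power2_eq_square algebra_simps inner_commute)
  moreover have "w \<bullet> (E *v w) = 0" by (rule zero[OF nw])
  moreover have "2 * a * ((E *v n) \<bullet> w) \<ge> - (\<delta> * (w \<bullet> w) + a\<^sup>2 * (norm (E *v n))\<^sup>2 / \<delta>)"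
  proof -
    have "\<bar>2 * a * ((E *v n) \<bullet> w)\<bar> \<le> 2 * \<bar>a\<bar> * (norm (E *v n) * norm w)"
      using Cauchy_Schwarz_ineq2[of "E *v n" w] by (simp add: abs_mult mult_left_mono)
    moreover have "0 \<le> (\<delta> * norm w - \<bar>a\<bar> * norm (E *v n))\<^sup>2 / \<delta>"
      using \<open>\<delta> > 0\<close> by simp
    moreover have "(\<delta> * norm w - \<bar>a\<bar> * norm (E *v n))\<^sup>2 / \<delta>
       = \<delta> * (norm w)\<^sup>2 + a\<^sup>2 * (norm (E *v n))\<^sup>2 / \<delta> - 2 * \<bar>a\<bar> * (norm (E *v n) * norm w)"
      using \<open>\<delta> > 0\<close> by (simp add: power2_eq_square field_simps)
    ultimately show ?thesis by (simp add: dot_square_norm)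
  qed
  moreover have "a\<^sup>2 * (n \<bullet> (E *v n)) \<ge> - (a\<^sup>2 * \<bar>n \<bullet> (E *v n)\<bar>)"
    by (metis abs_ge_minus_self abs_mult abs_power2 minus_le_iff)
  moreover have "v \<bullet> v = a\<^sup>2 * (n \<bullet> n) + w \<bullet> w"
    unfolding v using nw by (simp add: inner_add_left inner_add_right inner_commute power2_eq_square)
  then have "\<delta> * (w \<bullet> w) \<le> \<delta> * (v \<bullet> v)" using nn \<open>\<delta> > 0\<close> by simp
  moreover have "q / (n \<bullet> n)\<^sup>2 * (n \<bullet> v)\<^sup>2 = a\<^sup>2 * \<bar>n \<bullet> (E *v n)\<bar> + a\<^sup>2 * (norm (E *v n))\<^sup>2 / \<delta>"
    using nn by (simp add: nv q_def power_mult_distrib field_simps)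
  ultimately show "0 \<le> v \<bullet> (E *v v) + q / (n \<bullet> n)\<^sup>2 * (n \<bullet> v)\<^sup>2 + \<delta> * (v \<bullet> v)"
    by linarith
qed

text \<open>The set where \<rho> > 0 is open and misses \<Omega>, so it misses the closure; a
  boundary point is not in \<Omega>, which excludes \<rho> < 0.\<close>

lemma local_defining_function_sign:
  assumes "open \<Omega>" and ld: "local_defining_function \<Omega> \<tau> U \<rho>"
  shows "x \<in> closure \<Omega> \<inter> U \<Longrightarrow> \<rho> x \<le> 0" and "x \<in> frontier \<Omega> \<inter> U \<Longrightarrow> \<rho> x = 0"
proof -
  have U: "open U" "smooth_on U \<rho>" "\<Omega> \<inter> U = {x \<in> U. \<rho> x < 0}"
    using ld by (auto simp: local_defining_function_def)
  have "open (U \<inter> \<rho> -` {0<..})"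
    by (intro continuous_open_preimage smooth_on_imp_continuous U) auto
  moreover have "\<rho> x < 0" if "x \<in> \<Omega>" "x \<in> U" for x using U(3) that by blast
  then have "(U \<inter> \<rho> -` {0<..}) \<inter> \<Omega> = {}" by force
  ultimately have "(U \<inter> \<rho> -` {0<..}) \<inter> closure \<Omega> = {}"
    by (simp add: open_Int_closure_eq_empty)
  then show le: "x \<in> closure \<Omega> \<inter> U \<Longrightarrow> \<rho> x \<le> 0" for x by force
  assume "x \<in> frontier \<Omega> \<inter> U"
  then have "x \<in> closure \<Omega> \<inter> U" "x \<notin> \<Omega>"
    using \<open>open \<Omega>\<close> by (auto simp: frontier_def interior_open)
  then show "\<rho> x = 0" using le[of x] U(3) by force
qed

text \<open>Squaring the defining function adds a large positive multiple of the normal direction to its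
  Hessian, so that strict convexity along the tangent space becomes strict positivity.\<close>
lemma boundary_barrier:
  fixes G :: "(real^'n^'n) set"
  assumes G: "psd_monotone G" and "open \<Omega>" and "smooth_boundary \<Omega>"
    and "strictly_bdry_convex (ray_set G) \<Omega>" and tau: "\<tau> \<in> frontier \<Omega>"
  obtains w r \<kappa> t\<^sub>0 where "r > 0" "\<kappa> > 0" "smooth_on (ball \<tau> r) w" "w \<tau> = 0"
    "\<And>x. x \<in> closure \<Omega> \<inter> ball \<tau> r \<Longrightarrow> w x \<le> - \<kappa> * (dist \<tau> x)\<^sup>2"
    "\<And>C x. C \<ge> t\<^sub>0 \<Longrightarrow> x \<in> ball \<tau> r \<Longrightarrow> C *\<^sub>R hess w x \<in> sym_interior G"
proof -
  obtain U \<rho> where ld: "local_defining_function \<Omega> \<tau> U \<rho>"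
    using assms by (auto simp: smooth_boundary_def)
  then have U: "open U" "\<tau> \<in> U" "smooth_on U \<rho>" "grad \<rho> \<tau> \<noteq> 0"
    by (auto simp: local_defining_function_def)
  obtain B where B: "B \<in> sym_interior (ray_set G)"
    "\<And>v. grad \<rho> \<tau> \<bullet> v = 0 \<Longrightarrow> v \<bullet> (hess \<rho> \<tau> *v v) = v \<bullet> (B *v v)"
    using assms(4) tau ld unfolding strictly_bdry_convex_def by blast
  obtain d t\<^sub>0 where d: "d > 0" "t\<^sub>0 > 0" "\<And>t. t \<ge> t\<^sub>0 \<Longrightarrow> t *\<^sub>R (B - d *\<^sub>R mat 1) \<in> G"
    using sym_interior_ray_set[OF G B(1)] by metis
  \<comment> \<open>A quarter of the margin each for the quadratic form estimate, the parabola
    subtracted in \<open>w\<close>, the variation of the Hessian near \<tau>, and staying in the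
    interior.\<close>
  define \<delta> where "\<delta> = d / 4"
  have \<delta>: "\<delta> > 0" "d = 4 * \<delta>" using d by (auto simp: \<delta>_def)
  let ?n = "grad \<rho> \<tau>" and ?H = "hess \<rho> \<tau>"
  have "B \<in> sym_mats"
    using B(1) unfolding sym_interior_def interior_of_def using openin_subset by fastforce
  then have E: "?H - B \<in> sym_mats" using hess_sym_mats[OF U(1,3,2)] by (intro sym_mats_diff)
  obtain l where l: "l \<ge> 0" "\<And>v. 0 \<le> v \<bullet> ((?H - B) *v v) + l * (?n \<bullet> v)\<^sup>2 + \<delta> * (v \<bullet> v)"
    using quadratic_form_nonneg_off_hyperplane[OF E U(4) _ \<delta>(1)] B(2)
    by (auto simp: matrix_vector_mult_diff_rdistrib inner_diff_right)
  \<comment> \<open>Since \<rho> vanishes at \<tau>, the Hessian of its square there is twice the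
    square of the gradient, and l / 2 produces exactly the normal term estimated above. The parabola
    makes \<open>w\<close> strictly negative on the closure away from \<tau>, at the cost of one
    \<delta>.\<close>
  define w where "w = (\<lambda>x. (\<rho> x + (l / 2) * (\<rho> x * \<rho> x)) - (\<delta> / 2) * ((x - \<tau>) \<bullet> (x - \<tau>)))"
  have s1: "smooth_on U (\<lambda>x. \<rho> x * \<rho> x)" by (rule smooth_on_mult[OF U(1,3,3)])
  have s2: "smooth_on U (\<lambda>x. (l / 2) * (\<rho> x * \<rho> x))" by (rule smooth_on_cmult[OF U(1) s1])
  have s3: "smooth_on U (\<lambda>x. \<rho> x + (l / 2) * (\<rho> x * \<rho> x))" by (rule smooth_on_add[OF U(1,3) s2])
  have s4: "smooth_on U (\<lambda>x. (\<delta> / 2) * ((x - \<tau>) \<bullet> (x - \<tau>)))"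
    by (rule smooth_on_cmult[OF U(1) smooth_on_sqdist])
  have w: "smooth_on U w" unfolding w_def by (rule smooth_on_diff[OF U(1) s3 s4])
  have \<rho>0: "\<rho> \<tau> = 0" using local_defining_function_sign(2)[OF \<open>open \<Omega>\<close> ld] tau U by blast
  have "hess w \<tau> = ?H + (l / 2) *\<^sub>R hess (\<lambda>x. \<rho> x * \<rho> x) \<tau> - \<delta> *\<^sub>R mat 1"
    unfolding w_def hess_diff[OF U(1) s3 s4 U(2)] hess_add[OF U(1,3) s2 U(2)] hess_cmult[OF U(1) s1 U(2)]
      hess_cmult[OF U(1) smooth_on_sqdist U(2)] by simp
  also have "hess (\<lambda>x. \<rho> x * \<rho> x) \<tau> = 2 *\<^sub>R (\<chi> i j. ?n $ i * ?n $ j)"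
    unfolding hess_mult[OF U(1,3,3,2)] by (simp add: \<rho>0 vec_eq_iff)
  finally have hw: "hess w \<tau> = ?H + l *\<^sub>R (\<chi> i j. ?n $ i * ?n $ j) - \<delta> *\<^sub>R mat 1" by simp
  have nn: "v \<bullet> ((\<chi> i j. ?n $ i * ?n $ j) *v v) = (?n \<bullet> v)\<^sup>2" for v
  proof -
    have "(\<chi> i j. ?n $ i * ?n $ j) *v v = (?n \<bullet> v) *\<^sub>R ?n"
      by (simp add: vec_eq_iff matrix_vector_mult_def inner_vec_def sum_distrib_left mult_ac del: grad_nth)
    then show ?thesis by (simp add: power2_eq_square inner_commute)
  qed
  have hs: "hess w \<tau> \<in> sym_mats" by (rule hess_sym_mats[OF U(1) w U(2)])
  have psd1: "hess w \<tau> - B + (2 * \<delta>) *\<^sub>R mat 1 \<in> psd_mats"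
  proof -
    have "0 \<le> v \<bullet> ((hess w \<tau> - B + (2 * \<delta>) *\<^sub>R mat 1) *v v)" for v
    proof -
      have eq: "hess w \<tau> - B + (2 * \<delta>) *\<^sub>R mat 1
          = (?H - B) + l *\<^sub>R (\<chi> i j. ?n $ i * ?n $ j) + \<delta> *\<^sub>R mat 1"
        unfolding hw by (simp add: vec_eq_iff algebra_simps)
      show ?thesis unfolding eq using l(2)[of v]
        by (simp add: matrix_vector_mult_add_rdistrib inner_add_right nn scaleR_matrix_vector_assoc[symmetric]
            del: grad_nth)
    qed
    then show ?thesis
      using hs \<open>B \<in> sym_mats\<close> by (simp add: psd_mats_def sym_mats_add sym_mats_diff sym_mats_scaleR sym_mats_mat)
  qed
  have "continuous (at \<tau>) (hess w)"
    using continuous_on_hess[OF w] U continuous_on_eq_continuous_at by blast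
  then obtain r1 where r1: "r1 > 0" "\<And>x. dist x \<tau> < r1 \<Longrightarrow> dist (hess w x) (hess w \<tau>) < \<delta>"
    using \<delta>(1) unfolding continuous_at_eps_delta by (metis dist_commute)
  have "continuous (at \<tau>) \<rho>"
    using smooth_on_imp_continuous[OF U(3)] U continuous_on_eq_continuous_at by blast
  \<comment> \<open>The radius with |\<rho>| < 2 / (l + 1) gives l |\<rho>| < 2, also when l = 0, so
    that \<rho> + (l / 2) \<rho>^2 keeps the sign of \<rho>.\<close>
  moreover have "2 / (l + 1) > 0" using l by simp
  ultimately obtain r2 where r2: "r2 > 0" "\<And>x. dist x \<tau> < r2 \<Longrightarrow> dist (\<rho> x) (\<rho> \<tau>) < 2 / (l + 1)"
    unfolding continuous_at_eps_delta by (metis dist_commute)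
  obtain r3 where r3: "r3 > 0" "ball \<tau> r3 \<subseteq> U" using U open_contains_ball by metis
  define r where "r = min r1 (min r2 r3)"
  have r: "r > 0" "ball \<tau> r \<subseteq> U" using r1 r2 r3 by (auto simp: r_def)
  show ?thesis
  proof (rule that[of r "\<delta> / 2" w t\<^sub>0])
    show "smooth_on (ball \<tau> r) w" using w r smooth_on_subset by blast
    show "w \<tau> = 0" by (simp add: w_def \<rho>0)
    fix x assume x: "x \<in> closure \<Omega> \<inter> ball \<tau> r"
    have "\<rho> x \<le> 0" using local_defining_function_sign(1)[OF \<open>open \<Omega>\<close> ld] x r by blast
    moreover have "1 + (l / 2) * \<rho> x \<ge> 0"
    proof -
      have "\<bar>\<rho> x\<bar> < 2 / (l + 1)"
        using r2(2)[of x] x by (simp add: r_def \<rho>0 dist_real_def dist_commute)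
      then have "(l + 1) * \<bar>\<rho> x\<bar> < 2" using l(1) by (simp add: field_simps)
      then have "l * \<bar>\<rho> x\<bar> < 2" by (simp add: algebra_simps)
      moreover have "l * (- \<rho> x) \<le> l * \<bar>\<rho> x\<bar>" using l(1) by (intro mult_left_mono) auto
      ultimately show ?thesis by simp
    qed
    ultimately have "\<rho> x * (1 + (l / 2) * \<rho> x) \<le> 0" by (simp add: mult_nonpos_nonneg)
    then show "w x \<le> - (\<delta> / 2) * (dist \<tau> x)\<^sup>2"
      by (simp add: w_def dot_square_norm dist_norm norm_minus_commute algebra_simps)
  next
    fix C x assume C: "C \<ge> t\<^sub>0" and x: "x \<in> ball \<tau> r"
    have "hess w x \<in> sym_mats" using hess_sym_mats[OF U(1) w] x r by blast
    then have "(hess w x - hess w \<tau>) + \<delta> *\<^sub>R mat 1 \<in> psd_mats"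
      using r1(2)[of x] x hs
      by (intro psd_mats_add_norm sym_mats_diff) (auto simp: r_def dist_norm norm_minus_commute)
    from psd_mats_scaleR[OF psd_mats_add[OF this psd1], of C]
    have "C *\<^sub>R ((hess w x - hess w \<tau>) + \<delta> *\<^sub>R mat 1 + (hess w \<tau> - B + (2 * \<delta>) *\<^sub>R mat 1)) \<in> psd_mats"
      using C d by simp
    also have "C *\<^sub>R ((hess w x - hess w \<tau>) + \<delta> *\<^sub>R mat 1 + (hess w \<tau> - B + (2 * \<delta>) *\<^sub>R mat 1))
      = (C *\<^sub>R hess w x - (C * \<delta>) *\<^sub>R mat 1) - C *\<^sub>R (B - d *\<^sub>R mat 1)"
      by (simp add: vec_eq_iff \<delta>(2) algebra_simps)
    finally have "C *\<^sub>R hess w x - (C * \<delta>) *\<^sub>R mat 1 \<in> G"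
      by (rule psd_monotoneD[OF G d(3)[OF C]])
    then show "C *\<^sub>R hess w x \<in> sym_interior G"
      using C d \<delta> by (intro sym_interiorI[OF G, of _ "C * \<delta>"]) auto
  qed (use r \<delta> in auto)
qed

section \<open>The envelope of the Perron supremum\<close>

text \<open>Taken relative to \<open>Z\<close>, since values outside the closed cylinder are
  arbitrary; the supremum includes the point itself, so the envelope dominates
  \<open>f\<close>.\<close>

definition usc_env :: "(real^'N) set \<Rightarrow> (real^'N \<Rightarrow> ereal) \<Rightarrow> real^'N \<Rightarrow> ereal" where
  "usc_env Z f z = (INF U\<in>{U. open U \<and> z \<in> U}. SUP w\<in>U \<inter> Z. f w)"

lemma le_usc_env: "z \<in> Z \<Longrightarrow> f z \<le> usc_env Z f z"
  unfolding usc_env_def by (auto intro!: INF_greatest SUP_upper)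

lemma usc_env_le_SUP: "open U \<Longrightarrow> z \<in> U \<Longrightarrow> usc_env Z f z \<le> (SUP w\<in>U \<inter> Z. f w)"
  unfolding usc_env_def by (auto intro!: INF_lower)

lemma usc_env_le:
  assumes "open U" "z \<in> U" "\<And>w. w \<in> U \<inter> Z \<Longrightarrow> f w \<le> c"
  shows "usc_env Z f z \<le> c"
  using usc_env_le_SUP[OF assms(1,2)] by (rule order_trans) (auto intro!: SUP_least assms(3))

lemma less_usc_env:
  assumes "a < usc_env Z f z" "open U" "z \<in> U"
  obtains w where "w \<in> U \<inter> Z" "a < f w"
  using less_le_trans[OF assms(1) usc_env_le_SUP[OF assms(2,3)]] by (auto simp: less_SUP_iff)

lemma usc_on_usc_env:
  assumes "\<And>z. z \<in> Z \<Longrightarrow> usc_env Z f z < \<infinity>"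
  shows "usc_on Z (usc_env Z f)"
  unfolding usc_on_iff
proof (intro conjI ballI allI impI)
  fix z a assume "z \<in> Z" "usc_env Z f z < ereal a"
  then obtain U where U: "open U" "z \<in> U" "(SUP w\<in>U \<inter> Z. f w) < ereal a"
    unfolding usc_env_def INF_less_iff by blast
  then show "\<exists>U. open U \<and> z \<in> U \<and> (\<forall>w\<in>U \<inter> Z. usc_env Z f w < ereal a)"
    by (intro exI[of _ U]) (auto intro: le_less_trans[OF usc_env_le_SUP])
qed (rule assms)

text \<open>Adding \<open>|z - x|\<^sup>4\<close> makes a touching point strict without changing the Hessian there.\<close>
lemma hess_add_quartic:
  assumes "open U" "smooth_on U g" "x \<in> U"
  defines "s \<equiv> \<lambda>z. (z - x) \<bullet> (z - x)"
  shows "smooth_on U (\<lambda>z. g z + s z * s z)" "hess (\<lambda>z. g z + s z * s z) x = hess g x"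
proof -
  have s: "smooth_on U s" unfolding s_def by (rule smooth_on_sqdist)
  have ss: "smooth_on U (\<lambda>z. s z * s z)" by (rule smooth_on_mult[OF assms(1) s s])
  show "smooth_on U (\<lambda>z. g z + s z * s z)" by (rule smooth_on_add[OF assms(1,2) ss])
  have "s x = 0" "pderiv_at i s x = 0" for i
    unfolding s_def pderiv_at_sqdist by simp_all
  then show "hess (\<lambda>z. g z + s z * s z) x = hess g x"
    unfolding hess_add[OF assms(1,2) ss assms(3)] hess_mult[OF assms(1) s s assms(3)]
    by (simp add: vec_eq_iff)
qed

text \<open>A test function for the envelope need not touch any member. Made strict, it can be
  shifted vertically to touch some member near x; the Hessian at that point lies in
  \<open>G\<close>, and closedness of \<open>G\<close> gives the limit.\<close>

lemma subharmonic_on_usc_env_SUP: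
  assumes G: "closed G" and Y: "Y \<subseteq> Z"
    and sub: "\<And>\<zeta>. \<zeta> \<in> \<F> \<Longrightarrow> subharmonic_on G Y \<zeta>"
    and fin: "\<And>z. z \<in> Z \<Longrightarrow> usc_env Z (\<lambda>z. SUP \<zeta>\<in>\<F>. \<zeta> z) z < \<infinity>"
  shows "subharmonic_on G Y (usc_env Z (\<lambda>z. SUP \<zeta>\<in>\<F>. \<zeta> z))"
  unfolding subharmonic_on_def
proof (intro conjI ballI allI impI)
  let ?f = "\<lambda>z. SUP \<zeta>\<in>\<F>. \<zeta> z"
  let ?e = "usc_env Z ?f"
  show "usc_on Y ?e" using usc_on_usc_env[OF fin] Y usc_on_subset by blast
  fix x g assume "x \<in> Y" "test_function Y ?e x g"
  then obtain U where U: "open U" "x \<in> U" "U \<subseteq> Y" "smooth_on U g"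
    and le: "\<And>z. z \<in> U \<Longrightarrow> ?e z \<le> ereal (g z)" and eq: "?e x = ereal (g x)"
    unfolding test_function_def by blast
  define s where "s = (\<lambda>z. (z - x) \<bullet> (z - x))"
  define q where "q = (\<lambda>z. g z + s z * s z)"
  have q: "smooth_on U q" "hess q x = hess g x"
    using hess_add_quartic[OF U(1,4,2)] unfolding q_def s_def by auto
  have sx: "s z = (dist x z)\<^sup>2" for z
    by (simp add: s_def dot_square_norm dist_norm norm_minus_commute)
  show "hess g x \<in> G"
  proof (subst closed_approachable[OF G, symmetric], intro allI impI)
    fix e :: real assume e: "e > 0"
    have "continuous (at x) (hess q)"
      using continuous_on_hess[OF q(1)] U continuous_on_eq_continuous_at by blast
    then obtain r1 where r1: "r1 > 0" "\<And>z. dist z x < r1 \<Longrightarrow> dist (hess q z) (hess q x) < e"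
      using e unfolding continuous_at_eps_delta by (metis dist_commute)
    obtain r2 where r2: "r2 > 0" "cball x r2 \<subseteq> U" using U open_contains_cball by metis
    define r where "r = min (r1 / 2) r2"
    have r: "r > 0" "r < r1" "cball x r \<subseteq> U" using r1 r2 by (auto simp: r_def)
    \<comment> \<open>The value of the quartic on the sphere of radius \<open>r\<close>. There a
      member minus \<open>q\<close> is at most -c, whereas near x some member exceeds q - c / 2 (two
      errors of c / 4), so the maximum over the ball is interior.\<close>
    define c where "c = r ^ 4"
    have c: "c > 0" using r by (simp add: c_def)
    define N where "N = (U \<inter> q -` {..< g x + c / 4}) \<inter> ball x r"
    have "open N" unfolding N_def
      by (intro open_Int continuous_open_preimage smooth_on_imp_continuous[OF q(1)] U) auto
    moreover have "x \<in> N" using U r c by (simp add: N_def q_def s_def)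
    moreover have "ereal (g x - c / 4) < ?e x" using eq c by simp
    ultimately obtain w where w: "w \<in> N" "ereal (g x - c / 4) < ?f w"
      using less_usc_env[of _ Z ?f x N] by blast
    then obtain \<zeta> where \<zeta>: "\<zeta> \<in> \<F>" "ereal (g x - c / 4) < \<zeta> w"
      by (auto simp: less_SUP_iff)
    have cY: "cball x r \<subseteq> Y" using r U by blast
    have "continuous_on (cball x r) (\<lambda>z. - q z)"
      using smooth_on_imp_continuous[OF q(1)] r(3) by (intro continuous_intros) (rule continuous_on_subset)
    then have "usc_on (cball x r) (\<lambda>z. \<zeta> z + ereal (- q z))"
      using sub[OF \<zeta>(1)] cY by (intro usc_on_add_continuous) (auto simp: subharmonic_on_def intro: usc_on_subset)
    then obtain z where z: "z \<in> cball x r"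
      "\<And>y. y \<in> cball x r \<Longrightarrow> \<zeta> y + ereal (- q y) \<le> \<zeta> z + ereal (- q z)"
      using usc_on_attains_max[of "cball x r"] r(1) by fastforce
    have "w \<in> cball x r" using w by (simp add: N_def)
    have "ereal (- c / 2) < \<zeta> w + ereal (- q w)"
      using \<zeta>(2) w(1) by (cases "\<zeta> w") (auto simp: N_def)
    then have big: "ereal (- c / 2) < \<zeta> z + ereal (- q z)"
      using z(2)[OF \<open>w \<in> cball x r\<close>] by (rule less_le_trans)
    have "dist x z \<noteq> r"
    proof
      assume "dist x z = r"
      then have qz: "q z = g z + c"
        by (simp add: q_def sx c_def power_mult[symmetric] power2_eq_square power4_eq_xxxx)
      have "z \<in> U" "z \<in> Z" using z(1) r(3) cY Y by auto
      have "\<zeta> z \<le> ?f z" using \<zeta>(1) by (rule SUP_upper)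
      also have "\<dots> \<le> ?e z" using \<open>z \<in> Z\<close> by (rule le_usc_env)
      also have "\<dots> \<le> ereal (g z)" using \<open>z \<in> U\<close> by (rule le)
      finally have "\<zeta> z + ereal (- q z) \<le> ereal (- c)" by (cases "\<zeta> z") (auto simp: qz)
      with big c show False by (cases "\<zeta> z + ereal (- q z)") auto
    qed
    then have zb: "z \<in> ball x r" using z(1) by simp
    have "hess q z \<in> G"
    proof (rule subharmonic_on_touching[OF sub[OF \<zeta>(1)], of "ball x r"])
      show "smooth_on (ball x r) q" using q(1) by (rule smooth_on_subset) (use r(3) ball_subset_cball in blast)
      show "ball x r \<subseteq> Y" using cY ball_subset_cball by blast
      show "\<zeta> z \<noteq> - \<infinity>" using big by auto
    qed (use zb z(2) in auto)
    moreover have "dist (hess q z) (hess g x) < e"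
      using r1(2)[of z] zb r(2) q(2) by (simp add: dist_commute)
    ultimately show "\<exists>y\<in>G. dist y (hess g x) < e" by blast
  qed
qed

lemma subharmonic_on_cong:
  assumes "\<And>z. z \<in> Y \<Longrightarrow> f z = g z"
  shows "subharmonic_on G Y f \<longleftrightarrow> subharmonic_on G Y g"
proof -
  have "test_function Y f x h \<longleftrightarrow> test_function Y g x h" for x h
    unfolding test_function_def using assms by (metis in_mono)
  then show ?thesis using usc_on_cong[of Y f g] assms by (simp add: subharmonic_on_def)
qed

lemma subharmonic_on_subset:
  assumes "subharmonic_on G Y f" "V \<subseteq> Y"
  shows "subharmonic_on G V f"
proof -
  have "test_function V f x h \<Longrightarrow> test_function Y f x h" for x h
    unfolding test_function_def using assms(2) by (metis order_trans)
  then show ?thesis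
    using assms usc_on_subset[of Y f V] by (auto simp: subharmonic_on_def)
qed

section \<open>Upper bounds uniform over the Perron family\<close>

locale perron_setting =
  fixes F :: "(real^'n^'n) set" and \<Omega> :: "(real^'n) set" and \<phi> :: "real^'n \<Rightarrow> real^'m \<Rightarrow> real"
  assumes F: "dirichlet_set F"
    and \<Omega>: "open \<Omega>" "bounded \<Omega>" "smooth_boundary \<Omega>"
    and \<phi>: "continuous_on (frontier \<Omega> \<times> UNIV) (\<lambda>(\<tau>, y). \<phi> \<tau> y)"
begin

lemma F_mono: "psd_monotone F"
  by (rule dirichlet_set_psd_monotone[OF F])

lemma perron_familyD:
  assumes "\<zeta> \<in> perron_family F \<Omega> \<phi>"
  shows "usc_on (cyl (closure \<Omega>)) \<zeta>" "subharmonic_on (star_psd F) (cyl \<Omega>) \<zeta>"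
    "\<tau> \<in> frontier \<Omega> \<Longrightarrow> \<zeta> (vjoin \<tau> y) \<le> ereal (\<phi> \<tau> y)"
  using assms by (auto simp: perron_family_def)

lemma closure_cases: "x \<in> closure \<Omega> \<Longrightarrow> x \<in> \<Omega> \<or> x \<in> frontier \<Omega>"
  using \<Omega>(1) by (auto simp: frontier_def interior_open)

lemma phi_bounded:
  obtains M where "\<And>\<tau> y. \<tau> \<in> frontier \<Omega> \<Longrightarrow> y \<in> cball y\<^sub>1 R \<Longrightarrow> \<bar>\<phi> \<tau> y\<bar> \<le> M"
proof -
  have "compact (frontier \<Omega> \<times> cball y\<^sub>1 R)"
    using \<Omega>(2) by (intro compact_Times compact_cball) (simp add: compact_frontier_bounded)
  then have "compact ((\<lambda>(\<tau>, y). \<phi> \<tau> y) ` (frontier \<Omega> \<times> cball y\<^sub>1 R))"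
    using \<phi> by (intro compact_continuous_image) (auto intro: continuous_on_subset)
  then obtain M where "\<forall>x\<in>(\<lambda>(\<tau>, y). \<phi> \<tau> y) ` (frontier \<Omega> \<times> cball y\<^sub>1 R). norm x \<le> M"
    using compact_imp_bounded bounded_iff by blast
  then show ?thesis using that[of M] by force
qed

text \<open>\<open>F\<close> is proper: if - 2 t I were in \<open>F\<close> for large t,
  monotonicity would put any given symmetric A into \<open>F\<close>. The factor 2 anticipates the
  Hessian of t |x|^2.\<close>

lemma exists_not_in_F:
  obtains t where "t \<ge> 0" "- ((2 * t) *\<^sub>R mat 1) \<notin> F"
proof -
  obtain A where A: "A \<in> sym_mats" "A \<notin> F" using F by (auto simp: dirichlet_set_def)
  obtain K where K: "\<And>t. t \<ge> K \<Longrightarrow> A + t *\<^sub>R mat 1 \<in> psd_mats"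
    using sym_mats_shift_psd[OF A(1)] by metis
  define t where "t = max K 0"
  have "- ((2 * t) *\<^sub>R mat 1) \<notin> F"
  proof
    assume "- ((2 * t) *\<^sub>R mat 1) \<in> F"
    moreover have "A - - ((2 * t) *\<^sub>R mat 1) \<in> psd_mats" using K[of "2 * t"] by (simp add: t_def)
    ultimately show False using psd_monotoneD[OF F_mono] A(2) by blast
  qed
  then show ?thesis using that[of t] by (simp add: t_def)
qed

text \<open>The parabola t |x|^2 is a global barrier for comparison, nonnegative and bounded on the
  closure. The data are bounded on a ball of radius 2, because comparison at a slice in the unit
  ball uses another unit in y.\<close>

lemma perron_family_locally_bounded:
  obtains M where "\<And>\<zeta> x y. \<zeta> \<in> perron_family F \<Omega> \<phi> \<Longrightarrow> x \<in> closure \<Omega> \<Longrightarrow> y \<in> cball y\<^sub>1 1 \<Longrightarrow>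
    \<zeta> (vjoin x y) \<le> ereal M"
proof -
  obtain t where t: "t \<ge> 0" "- ((2 * t) *\<^sub>R mat 1) \<notin> F" using exists_not_in_F by metis
  obtain M where M: "\<And>\<tau> y. \<tau> \<in> frontier \<Omega> \<Longrightarrow> y \<in> cball y\<^sub>1 2 \<Longrightarrow> \<bar>\<phi> \<tau> y\<bar> \<le> M"
    using phi_bounded by metis
  obtain R where R: "\<And>x. x \<in> closure \<Omega> \<Longrightarrow> norm x \<le> R"
    using bounded_closure[OF \<Omega>(2)] unfolding bounded_iff by blast
  \<comment> \<open>The \<open>x - 0\<close> matches the shape of the lemmas on squared
    distances.\<close>
  define v where "v = (\<lambda>x::real^'n. t * ((x - 0) \<bullet> (x - 0)))"
  have v: "smooth_on \<Omega> v" unfolding v_def by (rule smooth_on_cmult[OF \<Omega>(1) smooth_on_sqdist])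
  have hv: "- hess v x \<notin> F" if "x \<in> \<Omega>" for x
    unfolding v_def hess_cmult[OF \<Omega>(1) smooth_on_sqdist that] hess_sqdist using t(2) by (simp add: mult.commute)
  have v0: "v x \<ge> 0" for x using t(1) by (simp add: v_def)
  have vR: "v x \<le> t * R\<^sup>2" if "x \<in> closure \<Omega>" for x
    using R[OF that] t(1) by (simp add: v_def dot_square_norm mult_left_mono power_mono)
  have "\<zeta> (vjoin x y) \<le> ereal (M + t * R\<^sup>2)"
    if \<zeta>: "\<zeta> \<in> perron_family F \<Omega> \<phi>" and x: "x \<in> closure \<Omega>" and y: "y \<in> cball y\<^sub>1 1" for \<zeta> x y
  proof -
    have bd: "\<zeta> (vjoin x y') + ereal (v x) \<le> ereal (M + t * R\<^sup>2)"
      if x: "x \<in> frontier \<Omega>" and y': "y' \<in> cball y 1" for x y'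
    proof -
      have "y' \<in> cball y\<^sub>1 2" using y y' dist_triangle[of y\<^sub>1 y' y] by simp
      then have "\<phi> x y' \<le> M" using M[OF x] by fastforce
      moreover have "v x \<le> t * R\<^sup>2" using vR x by (simp add: frontier_def)
      ultimately have "\<phi> x y' + v x \<le> M + t * R\<^sup>2" by simp
      then show ?thesis using perron_familyD(3)[OF \<zeta> x, of y']
        by (cases "\<zeta> (vjoin x y')") auto
    qed
    have "\<zeta> (vjoin x y) + ereal (v x) \<le> ereal (M + t * R\<^sup>2)"
    proof (cases "x \<in> \<Omega>")
      case True
      show ?thesis
        by (rule comparison_at_slice[OF \<Omega>(1,2) perron_familyD(1,2)[OF \<zeta>] v _ hv zero_less_one bd True])
          (auto simp: v_def intro!: continuous_intros)
    next
      case False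
      then have "x \<in> frontier \<Omega>" using closure_cases x by blast
      then show ?thesis by (rule bd) simp
    qed
    then show ?thesis using v0[of x] by (cases "\<zeta> (vjoin x y)") auto
  qed
  then show ?thesis using that by blast
qed

text \<open>The neighbourhood is the same for all members, which is what the envelope needs.
  Comparison runs on \<Omega> cut by a small ball: on the boundary of \<Omega> continuity of \<phi>
  decides, on the sphere inside \<Omega> the steep barrier beats the a priori bound.\<close>

lemma perron_family_boundary_bound:
  assumes conv: "strictly_bdry_convex (ray_set (dual_set F)) \<Omega>"
    and tau: "\<tau> \<in> frontier \<Omega>" and eps: "\<epsilon> > 0"
  obtains N where "open N" "vjoin \<tau> y\<^sub>0 \<in> N"
    "\<And>\<zeta> z. \<zeta> \<in> perron_family F \<Omega> \<phi> \<Longrightarrow> z \<in> N \<inter> cyl (closure \<Omega>) \<Longrightarrow> \<zeta> z \<le> ereal (\<phi> \<tau> y\<^sub>0 + \<epsilon>)"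
proof -
  obtain w r \<kappa> t\<^sub>0 where r: "r > 0" and \<kappa>: "\<kappa> > 0" and w: "smooth_on (ball \<tau> r) w" "w \<tau> = 0"
    and wle: "\<And>x. x \<in> closure \<Omega> \<inter> ball \<tau> r \<Longrightarrow> w x \<le> - \<kappa> * (dist \<tau> x)\<^sup>2"
    and hw: "\<And>C x. C \<ge> t\<^sub>0 \<Longrightarrow> x \<in> ball \<tau> r \<Longrightarrow> C *\<^sub>R hess w x \<in> sym_interior (dual_set F)"
    using boundary_barrier[OF psd_monotone_dual_set[OF F_mono] \<Omega>(1,3) conv tau] by metis
  have "\<exists>d>0. \<forall>p\<in>frontier \<Omega> \<times> UNIV. dist p (\<tau>, y\<^sub>0) < d \<longrightarrow>
      dist (case p of (\<tau>, y) \<Rightarrow> \<phi> \<tau> y) (case (\<tau>, y\<^sub>0) of (\<tau>, y) \<Rightarrow> \<phi> \<tau> y) < \<epsilon> / 2"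
    using \<phi>[unfolded continuous_on_iff, rule_format, of "(\<tau>, y\<^sub>0)" "\<epsilon> / 2"] tau eps by simp
  then obtain d where d: "d > 0" "\<And>x y. x \<in> frontier \<Omega> \<Longrightarrow> dist (x, y) (\<tau>, y\<^sub>0) < d \<Longrightarrow>
      dist (\<phi> x y) (\<phi> \<tau> y\<^sub>0) < \<epsilon> / 2"
    by auto
  obtain M where M: "\<And>\<zeta> x y. \<zeta> \<in> perron_family F \<Omega> \<phi> \<Longrightarrow> x \<in> closure \<Omega> \<Longrightarrow> y \<in> cball y\<^sub>0 1 \<Longrightarrow>
    \<zeta> (vjoin x y) \<le> ereal M"
    using perron_family_locally_bounded by metis
  \<comment> \<open>Distances s in x and 2 \<eta> in y keep points within d of (\<tau>,
    \<open>y\<^sub>0\<close>). The factor 2 is needed because slices within \<eta> of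
    \<open>y\<^sub>0\<close> are compared on balls of radius \<eta>; 2 \<eta> <= 1 keeps M
    valid.\<close>
  define s where "s = min (r / 2) (d / 4)"
  define \<eta> where "\<eta> = min (d / 8) (1 / 2)"
  have s: "s > 0" "s < r" "s < d / 2" and \<eta>: "\<eta> > 0" "2 * \<eta> \<le> 1" "2 * \<eta> < d / 2"
    using r d(1) by (auto simp: s_def \<eta>_def)
  have phi: "\<phi> x y < \<phi> \<tau> y\<^sub>0 + \<epsilon> / 2"
    if "x \<in> frontier \<Omega>" "dist \<tau> x \<le> s" "dist y\<^sub>0 y \<le> 2 * \<eta>" for x y
  proof -
    have "dist (x, y) (\<tau>, y\<^sub>0) \<le> dist x \<tau> + dist y y\<^sub>0"
      unfolding dist_Pair_Pair by (rule sqrt_sum_squares_le_sum) auto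
    then have "dist (x, y) (\<tau>, y\<^sub>0) < d" using that s \<eta> by (simp add: dist_commute)
    then have "dist (\<phi> x y) (\<phi> \<tau> y\<^sub>0) < \<epsilon> / 2" by (rule d(2)[OF that(1)])
    then show ?thesis unfolding dist_real_def by linarith
  qed
  \<comment> \<open>Large enough for the ray condition and for C \<kappa> s^2 to absorb M on the
    sphere of radius s.\<close>
  define C where "C = max t\<^sub>0 (\<bar>M - \<phi> \<tau> y\<^sub>0\<bar> / (\<kappa> * s\<^sup>2))"
  have C: "C \<ge> t\<^sub>0" "C \<ge> 0" "M - C * \<kappa> * s\<^sup>2 \<le> \<phi> \<tau> y\<^sub>0"
  proof -
    have ks: "\<kappa> * s\<^sup>2 > 0" using \<kappa> s by simp
    show "C \<ge> t\<^sub>0" by (simp add: C_def)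
    show "C \<ge> 0" using ks by (simp add: C_def le_max_iff_disj)
    have "\<bar>M - \<phi> \<tau> y\<^sub>0\<bar> / (\<kappa> * s\<^sup>2) \<le> C" by (simp add: C_def)
    then have "\<bar>M - \<phi> \<tau> y\<^sub>0\<bar> \<le> C * (\<kappa> * s\<^sup>2)" using ks by (simp add: pos_divide_le_eq)
    then show "M - C * \<kappa> * s\<^sup>2 \<le> \<phi> \<tau> y\<^sub>0" by (simp add: mult.assoc)
  qed
  define v where "v = (\<lambda>x. C * w x)"
  define V where "V = \<Omega> \<inter> ball \<tau> s"
  have sr: "cball \<tau> s \<subseteq> ball \<tau> r" using s by auto
  have clV: "closure V \<subseteq> closure \<Omega> \<inter> cball \<tau> s"
    unfolding V_def by (rule closure_minimal) (use closure_subset[of \<Omega>] in auto)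
  have V: "open V" "bounded V" "V \<subseteq> \<Omega>"
    using \<Omega>(1,2) by (auto simp: V_def intro: bounded_Int)
  have smv: "smooth_on (ball \<tau> r) v"
    unfolding v_def by (rule smooth_on_cmult[OF open_ball w(1)])
  have v1: "smooth_on V v" by (rule smooth_on_subset[OF smv]) (use s in \<open>auto simp: V_def\<close>)
  have v2: "continuous_on (closure V) v"
    by (rule continuous_on_subset[OF smooth_on_imp_continuous[OF smv]]) (use clV sr in blast)
  have v3: "- hess v x \<notin> F" if "x \<in> V" for x
  proof -
    have x: "x \<in> ball \<tau> r" using that s by (auto simp: V_def)
    have "hess v x = C *\<^sub>R hess w x" unfolding v_def by (rule hess_cmult[OF open_ball w(1) x])
    then have "hess v x \<in> sym_interior (dual_set F)" using hw[OF C(1) x] by simp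
    then show ?thesis by (rule sym_interior_dual_set[OF F_mono])
  qed
  have wle0: "v x \<le> 0" if "x \<in> closure \<Omega> \<inter> ball \<tau> r" for x
  proof -
    have "w x \<le> 0" using wle[OF that] \<kappa> by (smt (verit) mult_nonneg_nonneg mult_minus_left zero_le_power2)
    then show ?thesis using C(2) by (simp add: v_def mult_nonneg_nonpos)
  qed
  have bdV: "\<zeta> (vjoin x y') + ereal (v x) \<le> ereal (\<phi> \<tau> y\<^sub>0 + \<epsilon> / 2)"
    if \<zeta>: "\<zeta> \<in> perron_family F \<Omega> \<phi>" and x: "x \<in> frontier V" and y': "dist y\<^sub>0 y' \<le> 2 * \<eta>" for \<zeta> x y'
  proof -
    have xc: "x \<in> closure \<Omega>" "dist \<tau> x \<le> s" and xV: "x \<notin> V"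
      using x clV V(1) by (auto simp: frontier_def interior_open)
    have xr: "x \<in> closure \<Omega> \<inter> ball \<tau> r" using xc s by auto
    show ?thesis
    proof (cases "x \<in> \<Omega>")
      case True
      then have "dist \<tau> x = s" using xV xc by (auto simp: V_def)
      then have "w x \<le> - \<kappa> * s\<^sup>2" using wle[OF xr] by simp
      then have "v x \<le> C * (- \<kappa> * s\<^sup>2)" unfolding v_def using C(2) by (rule mult_left_mono)
      then have "M + v x \<le> \<phi> \<tau> y\<^sub>0 + \<epsilon> / 2" using C(3) eps by (simp add: mult.assoc)
      moreover have "\<zeta> (vjoin x y') \<le> ereal M" using M[OF \<zeta> xc(1)] y' \<eta> by simp
      ultimately show ?thesis by (cases "\<zeta> (vjoin x y')") auto
    next
      case False
      then have xf: "x \<in> frontier \<Omega>" using closure_cases xc by blast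
      have "\<phi> x y' + v x \<le> \<phi> \<tau> y\<^sub>0 + \<epsilon> / 2" using phi[OF xf xc(2) y'] wle0[OF xr] by simp
      then show ?thesis using perron_familyD(3)[OF \<zeta> xf, of y'] by (cases "\<zeta> (vjoin x y')") auto
    qed
  qed
  \<comment> \<open>Comparison bounds \<zeta> + v. As v vanishes at \<tau>, removing it nearby costs
    the second half of \<epsilon>.\<close>
  have "continuous (at \<tau>) v"
    using smooth_on_imp_continuous[OF smv] r by (simp add: continuous_on_eq_continuous_at)
  moreover have "\<epsilon> / 2 > 0" using eps by simp
  ultimately obtain r' where r': "r' > 0" "\<And>x. dist x \<tau> < r' \<Longrightarrow> dist (v x) (v \<tau>) < \<epsilon> / 2"
    unfolding continuous_at_eps_delta by metis
  define N :: "(real^('n+'m)) set" where "N = sel Inl -` ball \<tau> (min s r') \<inter> sel Inr -` ball y\<^sub>0 \<eta>"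
  have "open N" unfolding N_def by (intro open_Int open_vimage_sel open_ball)
  moreover have "vjoin \<tau> y\<^sub>0 \<in> N" using s r' \<eta> by (simp add: N_def)
  moreover have "\<zeta> z \<le> ereal (\<phi> \<tau> y\<^sub>0 + \<epsilon>)"
    if \<zeta>: "\<zeta> \<in> perron_family F \<Omega> \<phi>" and z: "z \<in> N \<inter> cyl (closure \<Omega>)" for \<zeta> z
  proof -
    define x where "x = sel Inl z"
    define y where "y = sel Inr z"
    have zxy: "z = vjoin x y" by (simp add: x_def y_def)
    have x: "x \<in> closure \<Omega>" "dist \<tau> x < s" "dist \<tau> x < r'" and y: "dist y\<^sub>0 y < \<eta>"
      using z by (auto simp: N_def cyl_iff x_def y_def)
    show ?thesis
    proof (cases "x \<in> \<Omega>")
      case True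
      have "\<zeta> (vjoin x y) + ereal (v x) \<le> ereal (\<phi> \<tau> y\<^sub>0 + \<epsilon> / 2)"
      proof (rule comparison_at_slice[OF V(1,2) _ _ v1 v2 v3 \<eta>(1)])
        show "usc_on (cyl (closure V)) \<zeta>"
          using perron_familyD(1)[OF \<zeta>] by (rule usc_on_subset) (use clV in \<open>auto simp: cyl_iff\<close>)
        show "subharmonic_on (star_psd F) (cyl V) \<zeta>"
          using perron_familyD(2)[OF \<zeta>] by (rule subharmonic_on_subset) (use V(3) in \<open>auto simp: cyl_iff\<close>)
        show "x \<in> V" using True x by (simp add: V_def)
        fix x' y' assume "x' \<in> frontier V" "y' \<in> cball y \<eta>"
        then show "\<zeta> (vjoin x' y') + ereal (v x') \<le> ereal (\<phi> \<tau> y\<^sub>0 + \<epsilon> / 2)"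
          using y dist_triangle[of y\<^sub>0 y' y] by (intro bdV[OF \<zeta>]) auto
      qed
      moreover have "\<bar>v x\<bar> < \<epsilon> / 2"
        using r'(2)[of x] x by (simp add: v_def w dist_commute dist_real_def)
      ultimately show ?thesis unfolding zxy by (cases "\<zeta> (vjoin x y)") auto
    next
      case False
      then have xf: "x \<in> frontier \<Omega>" using closure_cases x by blast
      have "\<phi> x y \<le> \<phi> \<tau> y\<^sub>0 + \<epsilon>" using phi[OF xf, of y] x y \<eta> eps by simp
      then show ?thesis using perron_familyD(3)[OF \<zeta> xf, of y] unfolding zxy
        by (metis ereal_less_eq(3) order_trans)
    qed
  qed
  ultimately show ?thesis using that by blast
qed

text \<open>The local bound makes the envelope finite above, the uniform boundary neighbourhoods
  control it over the boundary, and subharmonicity comes from closedness of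
  \<open>star_psd F\<close>.\<close>

lemma usc_env_perron_sup_in_family:
  assumes conv: "strictly_bdry_convex (ray_set (dual_set F)) \<Omega>"
  shows "usc_env (cyl (closure \<Omega>)) (perron_sup F \<Omega> \<phi>) \<in> perron_family F \<Omega> \<phi>"
proof -
  let ?Z = "cyl (closure \<Omega>) :: (real^('n+'m)) set" and ?\<Phi> = "perron_sup F \<Omega> \<phi> :: real^('n+'m) \<Rightarrow> ereal"
  have fin: "usc_env ?Z ?\<Phi> z < \<infinity>" if "z \<in> ?Z" for z
  proof -
    obtain M where M: "\<And>\<zeta> x y. \<zeta> \<in> perron_family F \<Omega> \<phi> \<Longrightarrow> x \<in> closure \<Omega> \<Longrightarrow> y \<in> cball (sel Inr z) 1 \<Longrightarrow>
      \<zeta> (vjoin x y) \<le> ereal M"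
      using perron_family_locally_bounded by metis
    have "usc_env ?Z ?\<Phi> z \<le> ereal M"
    proof (rule usc_env_le)
      show "open (sel Inr -` ball (sel Inr z :: real^'m) 1 :: (real^('n+'m)) set)" by (intro open_vimage_sel open_ball)
      fix w assume "w \<in> sel Inr -` ball (sel Inr z) 1 \<inter> ?Z"
      then show "?\<Phi> w \<le> ereal M"
        unfolding perron_sup_def using M[of _ "sel Inl w" "sel Inr w"]
        by (intro SUP_least) (simp add: cyl_iff)
    qed simp
    then show ?thesis using le_less_trans by fastforce
  qed
  have "usc_env ?Z ?\<Phi> (vjoin \<tau> y) \<le> ereal (\<phi> \<tau> y)" if tau: "\<tau> \<in> frontier \<Omega>" for \<tau> y
  proof (rule ereal_le_epsilon2)
    fix e :: real assume "e > 0"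
    obtain N where N: "open N" "vjoin \<tau> y \<in> N"
      "\<And>\<zeta> z. \<zeta> \<in> perron_family F \<Omega> \<phi> \<Longrightarrow> z \<in> N \<inter> ?Z \<Longrightarrow> \<zeta> z \<le> ereal (\<phi> \<tau> y + e)"
      using perron_family_boundary_bound[OF conv tau \<open>e > 0\<close>] by metis
    have "usc_env ?Z ?\<Phi> (vjoin \<tau> y) \<le> ereal (\<phi> \<tau> y + e)"
      by (rule usc_env_le[OF N(1,2)]) (auto simp: perron_sup_def intro!: SUP_least N(3))
    then show "usc_env ?Z ?\<Phi> (vjoin \<tau> y) \<le> ereal (\<phi> \<tau> y) + ereal e" by simp
  qed
  moreover have "subharmonic_on (star_psd F) (cyl \<Omega>) (usc_env ?Z ?\<Phi>)"
    unfolding perron_sup_def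
  proof (rule subharmonic_on_usc_env_SUP)
    show "closed (star_psd F :: (real^('n+'m)^('n+'m)) set)"
      using F by (intro closed_star_psd) (simp add: dirichlet_set_def)
    show "cyl \<Omega> \<subseteq> ?Z" using closure_subset[of \<Omega>] by (auto simp: cyl_iff)
    show "usc_env ?Z (\<lambda>z. SUP \<zeta>\<in>perron_family F \<Omega> \<phi>. \<zeta> z) z < \<infinity>" if "z \<in> ?Z" for z
      using fin[OF that] by (simp add: perron_sup_def[abs_def])
  qed (rule perron_familyD(2))
  ultimately show ?thesis
    unfolding perron_family_def using usc_on_usc_env[OF fin] by blast
qed

lemma subharmonic_on_perron_sup:
  assumes conv: "strictly_bdry_convex (ray_set (dual_set F)) \<Omega>"
  shows "subharmonic_on (star_psd F) (cyl \<Omega>) (perron_sup F \<Omega> \<phi> :: real^('n+'m) \<Rightarrow> ereal)"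
proof -
  let ?e = "usc_env (cyl (closure \<Omega>)) (perron_sup F \<Omega> \<phi>) :: real^('n+'m) \<Rightarrow> ereal"
  note e = usc_env_perron_sup_in_family[OF conv]
  have "?e z = perron_sup F \<Omega> \<phi> z" if "z \<in> cyl \<Omega>" for z
  proof (rule antisym)
    show "?e z \<le> perron_sup F \<Omega> \<phi> z" unfolding perron_sup_def[of F \<Omega> \<phi> z] by (rule SUP_upper[OF e])
    show "perron_sup F \<Omega> \<phi> z \<le> ?e z"
      using that closure_subset[of \<Omega>] by (intro le_usc_env) (auto simp: cyl_iff)
  qed
  then show ?thesis
    using perron_familyD(2)[OF e] subharmonic_on_cong[of "cyl \<Omega>" ?e "perron_sup F \<Omega> \<phi>" "star_psd F"] by simp
qed

lemma perron_sup_le_boundary: "\<tau> \<in> frontier \<Omega> \<Longrightarrow> perron_sup F \<Omega> \<phi> (vjoin \<tau> y) \<le> ereal (\<phi> \<tau> y)"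
  unfolding perron_sup_def by (auto intro!: SUP_least perron_familyD(3))

end

section \<open>Lower barriers\<close>

text \<open>A hyperplane separates the point (\<open>y\<^sub>0\<close>, \<open>f y\<^sub>0\<close>)
  from the strict epigraph, which does not contain it; once shown not to be vertical, its slope is a
  subgradient.\<close>

lemma convex_subgradient:
  fixes f :: "'a::euclidean_space \<Rightarrow> real"
  assumes "convex_on UNIV f"
  obtains u where "\<And>y. f y\<^sub>0 + u \<bullet> (y - y\<^sub>0) \<le> f y"
proof -
  let ?T = "{p :: 'a \<times> real. f (fst p) < snd p}"
  have cvx: "convex ?T"
  proof (rule convexI)
    fix p q :: "'a \<times> real" and a b :: real
    assume pq: "p \<in> ?T" "q \<in> ?T" and ab: "0 \<le> a" "0 \<le> b" "a + b = 1"
    have "f (a *\<^sub>R fst p + b *\<^sub>R fst q) \<le> a * f (fst p) + b * f (fst q)"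
      using assms ab unfolding convex_on_def by blast
    also have "\<dots> < a * snd p + b * snd q"
    proof (cases "a = 0")
      case False
      then show ?thesis using pq ab by (intro add_less_le_mono mult_left_mono) auto
    qed (use pq ab in auto)
    finally show "a *\<^sub>R p + b *\<^sub>R q \<in> ?T" by simp
  qed
  have "(y\<^sub>0, f y\<^sub>0 + 1) \<in> ?T" by simp
  then have ne: "?T \<noteq> {}" by blast
  have "\<exists>c b. c \<noteq> 0 \<and> (\<forall>p\<in>{(y\<^sub>0, f y\<^sub>0)}. c \<bullet> p \<le> b) \<and> (\<forall>p\<in>?T. b \<le> c \<bullet> p)"
    by (rule separating_hyperplane_sets[OF _ cvx _ ne]) auto
  then obtain c b where c: "c \<noteq> 0" "c \<bullet> (y\<^sub>0, f y\<^sub>0) \<le> b" "\<And>p. p \<in> ?T \<Longrightarrow> b \<le> c \<bullet> p"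
    by blast
  obtain a \<alpha> where ca: "c = (a, \<alpha>)" by force
  have ineq: "a \<bullet> y\<^sub>0 + \<alpha> * f y\<^sub>0 \<le> a \<bullet> y + \<alpha> * t" if "f y < t" for y t
    using c(2) c(3)[of "(y, t)"] that by (simp add: ca)
  have "\<alpha> \<ge> 0" using ineq[of y\<^sub>0 "f y\<^sub>0 + 1"] by (simp add: algebra_simps)
  \<comment> \<open>Since \<open>f\<close> is finite everywhere, a vertical hyperplane can be tested
    at \<open>y\<^sub>0 - a\<close>, which forces a = 0.\<close>
  moreover have "\<alpha> \<noteq> 0"
  proof
    assume "\<alpha> = 0"
    then have "a \<bullet> a \<le> 0"
      using ineq[of "y\<^sub>0 - a" "f (y\<^sub>0 - a) + 1"] by (simp add: inner_diff_right)
    then have "a = 0" by (metis inner_gt_zero_iff not_le)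
    then show False using \<open>\<alpha> = 0\<close> c(1) by (simp add: ca zero_prod_def)
  qed
  ultimately have \<alpha>: "\<alpha> > 0" by simp
  have "f y\<^sub>0 + (- a /\<^sub>R \<alpha>) \<bullet> (y - y\<^sub>0) \<le> f y" for y
  proof (rule field_le_epsilon)
    fix e :: real assume "e > 0"
    then have "a \<bullet> y\<^sub>0 + \<alpha> * f y\<^sub>0 \<le> a \<bullet> y + \<alpha> * (f y + e)" by (intro ineq) simp
    then show "f y\<^sub>0 + (- a /\<^sub>R \<alpha>) \<bullet> (y - y\<^sub>0) \<le> f y + e"
      using \<alpha> by (simp add: inner_diff_right field_simps)
  qed
  then show ?thesis using that by blast
qed

lemma legendre_ge: "ereal (y \<bullet> u - f y) \<le> legendre f u"
  unfolding legendre_def by (rule SUP_upper) simp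

lemma legendre_eq_at_subgradient:
  assumes "\<And>y. f y\<^sub>0 + u \<bullet> (y - y\<^sub>0) \<le> f y"
  shows "legendre f u = ereal (y\<^sub>0 \<bullet> u - f y\<^sub>0)"
proof (rule antisym)
  show "legendre f u \<le> ereal (y\<^sub>0 \<bullet> u - f y\<^sub>0)"
    unfolding legendre_def using assms
    by (intro SUP_least) (simp add: inner_diff_right inner_commute algebra_simps)
qed (rule legendre_ge)

text \<open>The Fenchel-Young inequality with slope \<open>u\<close>; comparability bounds all
  transforms at \<open>u\<close> by the finite one at \<open>\<tau>\<^sub>0\<close>.\<close>

lemma locally_comparable_lower_bound:
  assumes "locally_comparable T (\<lambda>\<tau>. legendre (f \<tau>))" "\<tau>\<^sub>0 \<in> T" "\<bar>legendre (f \<tau>\<^sub>0) u\<bar> \<noteq> \<infinity>"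
  obtains K where "\<And>\<tau> y. \<tau> \<in> T \<Longrightarrow> y \<bullet> u - K \<le> f \<tau> y"
proof -
  obtain C :: real where C: "\<forall>\<tau>\<in>T. \<forall>\<tau>'\<in>T.
        (legendre (f \<tau>) u = \<infinity> \<and> legendre (f \<tau>') u = \<infinity>) \<or>
        (legendre (f \<tau>) u \<noteq> \<infinity> \<and> legendre (f \<tau>') u \<noteq> \<infinity> \<and> \<bar>legendre (f \<tau>) u - legendre (f \<tau>') u\<bar> \<le> ereal C)"
    using assms(1) unfolding locally_comparable_def by blast
  obtain L where L: "legendre (f \<tau>\<^sub>0) u = ereal L" using assms(3) by auto
  have "y \<bullet> u - (L + C) \<le> f \<tau> y" if "\<tau> \<in> T" for \<tau> y
  proof -
    have "\<bar>legendre (f \<tau>) u - ereal L\<bar> \<le> ereal C" "legendre (f \<tau>) u \<noteq> \<infinity>"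
      using C that assms(2) L by force+
    then have "legendre (f \<tau>) u \<le> ereal (L + C)" by (cases "legendre (f \<tau>) u") auto
    from order_trans[OF legendre_ge[of y u "f \<tau>"] this] show ?thesis by simp
  qed
  then show ?thesis using that by blast
qed

text \<open>Finiteness of the transforms at the points \<open>u \<plusminus> d e\<^sub>i\<close> bounds all members of the family from
  below by one function growing linearly relative to \<open>u\<close>.\<close>
lemma locally_comparable_coercive:
  fixes f :: "'t \<Rightarrow> real^'m \<Rightarrow> real"
  assumes comp: "locally_comparable T (\<lambda>\<tau>. legendre (f \<tau>))" and \<tau>: "\<tau>\<^sub>0 \<in> T"
    and fin: "\<bar>legendre (f \<tau>\<^sub>0) u\<bar> \<noteq> \<infinity>"
  obtains \<delta> K where "\<delta> > 0" "\<And>\<tau> y. \<tau> \<in> T \<Longrightarrow> u \<bullet> y + \<delta> * norm y - K \<le> f \<tau> y"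
proof -
  have "open {u. \<bar>legendre (f \<tau>\<^sub>0) u\<bar> \<noteq> \<infinity>}"
    using comp \<tau> by (simp add: locally_comparable_def)
  then obtain e where e: "e > 0" "ball u e \<subseteq> {u. \<bar>legendre (f \<tau>\<^sub>0) u\<bar> \<noteq> \<infinity>}"
    by (rule openE[of _ u]) (use fin in simp)
  define d where "d = e / 2"
  have d: "d > 0" using e by (simp add: d_def)
  have "\<exists>K. \<forall>\<tau>\<in>T. \<forall>y. u \<bullet> y + d * \<bar>y $ i\<bar> - K \<le> f \<tau> y" for i
  proof -
    have p: "u + d *\<^sub>R axis i 1 \<in> ball u e" and m: "u - d *\<^sub>R axis i 1 \<in> ball u e"
      using d by (auto simp: dist_norm d_def)
    have 1: "\<bar>legendre (f \<tau>\<^sub>0) (u + d *\<^sub>R axis i 1)\<bar> \<noteq> \<infinity>"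
      using subsetD[OF e(2) p] by (rule CollectD)
    have 2: "\<bar>legendre (f \<tau>\<^sub>0) (u - d *\<^sub>R axis i 1)\<bar> \<noteq> \<infinity>"
      using subsetD[OF e(2) m] by (rule CollectD)
    obtain K1 where K1: "\<And>\<tau> y. \<tau> \<in> T \<Longrightarrow> y \<bullet> (u + d *\<^sub>R axis i 1) - K1 \<le> f \<tau> y"
      using locally_comparable_lower_bound[OF comp \<tau> 1] by metis
    obtain K2 where K2: "\<And>\<tau> y. \<tau> \<in> T \<Longrightarrow> y \<bullet> (u - d *\<^sub>R axis i 1) - K2 \<le> f \<tau> y"
      using locally_comparable_lower_bound[OF comp \<tau> 2] by metis
    have "u \<bullet> y + d * \<bar>y $ i\<bar> - max K1 K2 \<le> f \<tau> y" if "\<tau> \<in> T" for \<tau> y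
      using K1[OF that, of y] K2[OF that, of y]
      by (cases "y $ i \<ge> 0") (auto simp: inner_add_right inner_diff_right inner_commute[of y u])
    then show ?thesis by blast
  qed
  then obtain K where K: "\<And>i \<tau> y. \<tau> \<in> T \<Longrightarrow> u \<bullet> y + d * \<bar>y $ i\<bar> - K i \<le> f \<tau> y" by metis
  \<comment> \<open>Each coordinate bound controls only one |y_i|. Averaging them yields the sum of
    all |y_i|, at least |y|, with rate d / c.\<close>
  define c where "c = real CARD('m)"
  have c: "c > 0" by (simp add: c_def)
  have "u \<bullet> y + (d / c) * norm y - (\<Sum>i\<in>UNIV. K i) / c \<le> f \<tau> y" if "\<tau> \<in> T" for \<tau> y
  proof -
    have "(\<Sum>i\<in>UNIV. u \<bullet> y + d * \<bar>y $ i\<bar> - K i) \<le> (\<Sum>i\<in>(UNIV::'m set). f \<tau> y)"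
      by (intro sum_mono K that)
    then have "c * (u \<bullet> y) + d * (\<Sum>i\<in>UNIV. \<bar>y $ i\<bar>) - (\<Sum>i\<in>UNIV. K i) \<le> c * f \<tau> y"
      by (simp add: sum.distrib sum_subtractf sum_distrib_left c_def)
    moreover have "d * norm y \<le> d * (\<Sum>i\<in>UNIV. \<bar>y $ i\<bar>)"
      using d norm_le_l1_cart[of y] by (intro mult_left_mono) auto
    ultimately have "c * (u \<bullet> y) + d * norm y - (\<Sum>i\<in>UNIV. K i) \<le> c * f \<tau> y" by linarith
    then have "(c * (u \<bullet> y) + d * norm y - (\<Sum>i\<in>UNIV. K i)) / c \<le> f \<tau> y"
      using c by (simp add: pos_divide_le_eq mult.commute)
    then show ?thesis using c by (simp add: add_divide_distrib diff_divide_distrib)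
  qed
  moreover have "d / c > 0" using c d by simp
  ultimately show ?thesis using that by blast
qed

text \<open>If \<open>f\<close> lies above a smooth p with equality at z, then g - p has a local
  minimum there, so the Hessian of \<open>g\<close> dominates that of p. A maximum of smooth pieces
  has such a lower contact at every point.\<close>

lemma hess_in_star_psd_at_lower_contact:
  fixes f :: "real^('n::finite+'m::finite) \<Rightarrow> ereal" and v :: "real^'n \<Rightarrow> real" and u :: "real^'m"
  assumes F: "psd_monotone F" and V: "open V" "smooth_on V v" "sel Inl z \<in> V"
    and hv: "hess v (sel Inl z) \<in> F"
    and eq: "f z = ereal (v (sel Inl z) + u \<bullet> sel Inr z)"
    and le: "\<And>z'. sel Inl z' \<in> V \<Longrightarrow> ereal (v (sel Inl z') + u \<bullet> sel Inr z') \<le> f z'"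
    and g: "test_function Y f z g"
  shows "hess g z \<in> star_psd F"
proof -
  obtain U where U: "open U" "z \<in> U" "smooth_on U g" "\<And>z'. z' \<in> U \<Longrightarrow> f z' \<le> ereal (g z')"
    "f z = ereal (g z)"
    using g unfolding test_function_def by blast
  define p where "p = (\<lambda>z. v (sel Inl z) + (u \<bullet> sel Inr z + 0))"
  define W where "W = U \<inter> cyl V"
  have W: "open W" "z \<in> W" using U V by (auto simp: W_def cyl_iff open_cyl open_Int)
  have gW: "smooth_on W g" using U(3) by (rule smooth_on_subset) (simp add: W_def)
  have pW: "smooth_on W p"
    using smooth_on_split[OF V(1,2) smooth_on_affine[of UNIV u 0]] unfolding p_def
    by (rule smooth_on_subset) (simp add: W_def)
  have dle: "g z - p z \<le> g z' - p z'" if "z' \<in> W" for z'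
  proof -
    have "ereal (p z') \<le> f z'" using le[of z'] that by (simp add: W_def cyl_iff p_def)
    also have "\<dots> \<le> ereal (g z')" using U(4)[of z'] that by (simp add: W_def)
    finally have "p z' \<le> g z'" by simp
    moreover have "p z = g z" using eq U(5) by (simp add: p_def)
    ultimately show ?thesis by simp
  qed
  have "sel Inl w \<bullet> (hess v (sel Inl z) *v sel Inl w) \<le> w \<bullet> (hess g z *v w)" for w
  proof -
    have "0 \<le> w \<bullet> (hess (\<lambda>z. g z - p z) z *v w)"
      by (rule hess_nonneg_at_local_min[OF W(1) smooth_on_diff[OF W(1) gW pW] W(2) dle])
    also have "hess (\<lambda>z. g z - p z) z = hess g z - hess p z"
      by (rule hess_diff[OF W(1) gW pW W(2)])
    finally have "w \<bullet> (hess p z *v w) \<le> w \<bullet> (hess g z *v w)"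
      by (simp add: matrix_vector_mult_diff_rdistrib inner_diff_right)
    also have "w \<bullet> (hess p z *v w) = sel Inl w \<bullet> (hess v (sel Inl z) *v sel Inl w)"
      unfolding p_def hess_split[OF V(1,2) smooth_on_affine[of UNIV u 0] V(3)]
      by (simp add: inner_sum_type del: add_0_right)
    finally show ?thesis .
  qed
  then show ?thesis by (rule star_psdI[OF F hv hess_sym_mats[OF U(1,3,2)]])
qed

section \<open>Competitors for the lower bound\<close>

context perron_setting
begin

text \<open>The local bound holds for all y at once: coercivity settles large y, uniform continuity
  on a compact set the rest. The cruder global bound has the same slope \<open>u\<close>, so the two
  can be glued in x alone.\<close>

lemma phi_affine_minorant:
  assumes conv: "convex_on UNIV (\<phi> \<tau>\<^sub>0)"
    and comp: "locally_comparable (frontier \<Omega>) (\<lambda>\<tau>. legendre (\<phi> \<tau>))"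
    and \<tau>: "\<tau>\<^sub>0 \<in> frontier \<Omega>" and "\<epsilon> > 0"
  obtains u K r where "r > 0" "\<And>\<tau> y. \<tau> \<in> frontier \<Omega> \<Longrightarrow> u \<bullet> y - K \<le> \<phi> \<tau> y"
    "\<And>\<tau> y. \<tau> \<in> frontier \<Omega> \<inter> ball \<tau>\<^sub>0 r \<Longrightarrow> u \<bullet> y + (\<phi> \<tau>\<^sub>0 y\<^sub>0 - u \<bullet> y\<^sub>0) - \<epsilon> \<le> \<phi> \<tau> y"
proof -
  obtain u where u: "\<And>y. \<phi> \<tau>\<^sub>0 y\<^sub>0 + u \<bullet> (y - y\<^sub>0) \<le> \<phi> \<tau>\<^sub>0 y"
    using convex_subgradient[OF conv] by metis
  have "\<bar>legendre (\<phi> \<tau>\<^sub>0) u\<bar> \<noteq> \<infinity>"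
    unfolding legendre_eq_at_subgradient[of "\<phi> \<tau>\<^sub>0" y\<^sub>0 u, OF u] by simp
  then obtain \<delta> K where \<delta>: "\<delta> > 0" and K: "\<And>\<tau> y. \<tau> \<in> frontier \<Omega> \<Longrightarrow> u \<bullet> y + \<delta> * norm y - K \<le> \<phi> \<tau> y"
    using locally_comparable_coercive[OF comp \<tau>] by metis
  \<comment> \<open>Beyond norm R the coercive bound already exceeds the affine function through
    (\<open>y\<^sub>0\<close>, \<open>\<phi> \<tau>\<^sub>0 y\<^sub>0\<close>).\<close>
  define R where "R = (K + \<phi> \<tau>\<^sub>0 y\<^sub>0 - u \<bullet> y\<^sub>0) / \<delta>"
  have "compact (frontier \<Omega> \<times> cball (0::real^'m) R)"
    using \<Omega>(2) by (intro compact_Times compact_cball) (simp add: compact_frontier_bounded)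
  then have "uniformly_continuous_on (frontier \<Omega> \<times> cball 0 R) (\<lambda>(\<tau>, y). \<phi> \<tau> y)"
    using \<phi> by (intro compact_uniformly_continuous) (auto intro: continuous_on_subset)
  from this[unfolded uniformly_continuous_on_def, rule_format, OF \<open>\<epsilon> > 0\<close>]
  obtain r where r: "r > 0" "\<And>p p'. p \<in> frontier \<Omega> \<times> cball 0 R \<Longrightarrow> p' \<in> frontier \<Omega> \<times> cball 0 R \<Longrightarrow>
      dist p' p < r \<Longrightarrow> dist (case p' of (\<tau>, y) \<Rightarrow> \<phi> \<tau> y) (case p of (\<tau>, y) \<Rightarrow> \<phi> \<tau> y) < \<epsilon>"
    by blast
  have "u \<bullet> y + (\<phi> \<tau>\<^sub>0 y\<^sub>0 - u \<bullet> y\<^sub>0) - \<epsilon> \<le> \<phi> \<tau> y" if "\<tau> \<in> frontier \<Omega> \<inter> ball \<tau>\<^sub>0 r" for \<tau> y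
  proof (cases "norm y \<le> R")
    case True
    have "dist (\<phi> \<tau> y) (\<phi> \<tau>\<^sub>0 y) < \<epsilon>"
      using r(2)[of "(\<tau>\<^sub>0, y)" "(\<tau>, y)"] that \<tau> True by (simp add: dist_Pair_Pair dist_commute)
    then show ?thesis using u[of y] by (simp add: dist_real_def inner_diff_right)
  next
    case False
    then have "K + \<phi> \<tau>\<^sub>0 y\<^sub>0 - u \<bullet> y\<^sub>0 < \<delta> * norm y"
      using \<delta> by (simp add: R_def field_simps)
    then show ?thesis using K[of \<tau> y] that \<open>\<epsilon> > 0\<close> by simp
  qed
  moreover have "u \<bullet> y - K \<le> \<phi> \<tau> y" if "\<tau> \<in> frontier \<Omega>" for \<tau> y
  proof -
    have "0 \<le> \<delta> * norm y" using \<delta> by simp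
    then show ?thesis using K[OF that, of y] by linarith
  qed
  ultimately show ?thesis using that r(1) by blast
qed

text \<open>Non-emptiness of \<open>F\<close> and monotonicity admit large multiples of the
  identity; again 2 t I is the Hessian of t |x|^2.\<close>

lemma exists_scalar_in_F:
  obtains t where "t \<ge> 0" "(2 * t) *\<^sub>R mat 1 \<in> F"
proof -
  obtain A where A: "A \<in> F" using F by (auto simp: dirichlet_set_def)
  then have "A \<in> sym_mats" using F_mono by (auto simp: psd_monotone_def)
  then have "0 - A \<in> sym_mats" by (rule sym_mats_diff[OF zero_sym_mats])
  then obtain K where K: "\<And>t. t \<ge> K \<Longrightarrow> (0 - A) + t *\<^sub>R mat 1 \<in> psd_mats"
    using sym_mats_shift_psd by metis
  have "(2 * max K 0) *\<^sub>R mat 1 \<in> F"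
    by (rule psd_monotoneD[OF F_mono A]) (use K[of "2 * max K 0"] in simp)
  then show ?thesis using that[of "max K 0"] by simp
qed

text \<open>The competitor is h(x) + u . y. Near \<tau> the barrier \<open>v\<close> may win; away
  from it the parabola \<open>q\<close> is low enough for all boundary data. At each point one of
  the two is a smooth lower contact for \<open>h\<close>.\<close>

lemma perron_sup_ge_boundary:
  assumes bconv: "strictly_bdry_convex (ray_set F) \<Omega>" and conv: "convex_on UNIV (\<phi> \<tau>)"
    and comp: "locally_comparable (frontier \<Omega>) (\<lambda>\<tau>. legendre (\<phi> \<tau>))"
    and tau: "\<tau> \<in> frontier \<Omega>"
  shows "ereal (\<phi> \<tau> y\<^sub>0) \<le> perron_sup F \<Omega> \<phi> (vjoin \<tau> y\<^sub>0)"
proof (rule ereal_le_epsilon2)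
  fix \<epsilon> :: real assume eps: "\<epsilon> > 0"
  obtain u K r1 where r1: "r1 > 0" and K: "\<And>\<tau> y. \<tau> \<in> frontier \<Omega> \<Longrightarrow> u \<bullet> y - K \<le> \<phi> \<tau> y"
    and near: "\<And>\<tau>' y. \<tau>' \<in> frontier \<Omega> \<inter> ball \<tau> r1 \<Longrightarrow> u \<bullet> y + (\<phi> \<tau> y\<^sub>0 - u \<bullet> y\<^sub>0) - \<epsilon> \<le> \<phi> \<tau>' y"
    using phi_affine_minorant[OF conv comp tau eps] by metis
  obtain w r2 \<kappa> t\<^sub>0 where r2: "r2 > 0" and \<kappa>: "\<kappa> > 0" and w: "smooth_on (ball \<tau> r2) w" "w \<tau> = 0"
    and wle: "\<And>x. x \<in> closure \<Omega> \<inter> ball \<tau> r2 \<Longrightarrow> w x \<le> - \<kappa> * (dist \<tau> x)\<^sup>2"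
    and hw: "\<And>C x. C \<ge> t\<^sub>0 \<Longrightarrow> x \<in> ball \<tau> r2 \<Longrightarrow> C *\<^sub>R hess w x \<in> sym_interior F"
    using boundary_barrier[OF F_mono \<Omega>(1,3) bconv tau] by metis
  obtain t where t: "t \<ge> 0" "(2 * t) *\<^sub>R mat 1 \<in> F" using exists_scalar_in_F by metis
  obtain R where R: "\<And>x. x \<in> closure \<Omega> \<Longrightarrow> norm x \<le> R"
    using bounded_closure[OF \<Omega>(2)] unfolding bounded_iff by blast
  define s where "s = min r1 r2"
  have s: "s > 0" "s \<le> r1" "s \<le> r2" using r1 r2 by (auto simp: s_def)
  \<comment> \<open>On the closure t |x|^2 <= t R^2, so subtracting L puts \<open>q\<close> below
    -K, while q >= -L everywhere.\<close>
  define L where "L = K + t * R\<^sup>2"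
  define c where "c = \<phi> \<tau> y\<^sub>0 - u \<bullet> y\<^sub>0 - \<epsilon>"
  define q where "q = (\<lambda>x::real^'n. t * ((x - 0) \<bullet> (x - 0)) + - L)"
  \<comment> \<open>Makes \<open>v\<close> at most -L, hence at most \<open>q\<close>, at distance s
    / 2 or more from \<tau>, and meets the ray condition.\<close>
  define C where "C = max t\<^sub>0 (\<bar>c + L\<bar> / (\<kappa> * (s / 2)\<^sup>2))"
  define v where "v = (\<lambda>x. C * w x + c)"
  define h where "h = (\<lambda>x. if x \<in> ball \<tau> s then max (v x) (q x) else q x)"
  have C: "C \<ge> t\<^sub>0" "C \<ge> 0" "c + L \<le> C * (\<kappa> * (s / 2)\<^sup>2)"
  proof -
    have ks: "\<kappa> * (s / 2)\<^sup>2 > 0" using \<kappa> s by simp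
    show "C \<ge> t\<^sub>0" by (simp add: C_def)
    show "C \<ge> 0" using ks by (simp add: C_def le_max_iff_disj)
    have "\<bar>c + L\<bar> / (\<kappa> * (s / 2)\<^sup>2) \<le> C" by (simp add: C_def)
    then have "\<bar>c + L\<bar> \<le> C * (\<kappa> * (s / 2)\<^sup>2)" using ks by (simp only: pos_divide_le_eq)
    then show "c + L \<le> C * (\<kappa> * (s / 2)\<^sup>2)" by linarith
  qed
  have q_le: "q x \<le> - K" if "x \<in> closure \<Omega>" for x
    using R[OF that] t(1) by (simp add: q_def L_def dot_square_norm mult_left_mono power_mono)
  have q_ge: "- L \<le> q x" for x using t(1) by (simp add: q_def)
  have v_le: "v x \<le> c" if "x \<in> closure \<Omega> \<inter> ball \<tau> s" for x
  proof -
    have "w x \<le> - \<kappa> * (dist \<tau> x)\<^sup>2" by (rule wle) (use that s in auto)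
    also have "\<dots> \<le> 0" using \<kappa> by simp
    finally show ?thesis using C(2) by (simp add: v_def mult_nonneg_nonpos)
  qed
  have v_le_q: "v x \<le> q x" if x: "x \<in> closure \<Omega> \<inter> ball \<tau> s" and far: "s / 2 \<le> dist \<tau> x" for x
  proof -
    have "w x \<le> - \<kappa> * (dist \<tau> x)\<^sup>2" by (rule wle) (use x s in auto)
    moreover have "\<kappa> * (s / 2)\<^sup>2 \<le> \<kappa> * (dist \<tau> x)\<^sup>2"
      using far s \<kappa> by (intro mult_left_mono power_mono) auto
    ultimately have "C * w x \<le> C * - (\<kappa> * (s / 2)\<^sup>2)"
      using C(2) by (intro mult_left_mono) auto
    then have "v x \<le> - L" using C(3) by (simp add: v_def)
    then show ?thesis using q_ge[of x] by linarith
  qed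
  have qs: "smooth_on UNIV q"
    unfolding q_def by (rule smooth_on_add[OF open_UNIV smooth_on_cmult[OF open_UNIV smooth_on_sqdist] smooth_on_const])
  have hq: "hess q x \<in> F" for x
    unfolding q_def hess_add[OF open_UNIV smooth_on_cmult[OF open_UNIV smooth_on_sqdist] smooth_on_const UNIV_I]
      hess_cmult[OF open_UNIV smooth_on_sqdist UNIV_I] hess_sqdist
    using t(2) by (simp add: mult.commute)
  have ws: "smooth_on (ball \<tau> s) w" by (rule smooth_on_subset[OF w(1)]) (use s in auto)
  have vs: "smooth_on (ball \<tau> s) v"
    unfolding v_def by (rule smooth_on_add[OF open_ball smooth_on_cmult[OF open_ball ws] smooth_on_const])
  have hv: "hess v x \<in> F" if x: "x \<in> ball \<tau> s" for x
  proof -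
    have "hess v x = C *\<^sub>R hess w x"
      unfolding v_def hess_add[OF open_ball smooth_on_cmult[OF open_ball ws] smooth_on_const x]
        hess_cmult[OF open_ball ws x] by simp
    then show ?thesis using hw[OF C(1), of x] x s sym_interior_subset[of F] by auto
  qed
  have hcont: "continuous_on (closure \<Omega>) h"
  proof -
    \<comment> \<open>The relatively open pieces overlap where s / 2 < |x - \<tau>| < s; there
      \<open>q\<close> dominates \<open>v\<close>, so the two expressions for \<open>h\<close>
      agree.\<close>
    let ?A = "closure \<Omega> \<inter> ball \<tau> s" and ?B = "closure \<Omega> \<inter> - cball \<tau> (s / 2)"
    have AB: "?A \<union> ?B = closure \<Omega>" using s by auto
    have "continuous_on ?A (\<lambda>x. max (v x) (q x))"
      by (intro continuous_on_max continuous_on_subset[OF smooth_on_imp_continuous[OF vs]]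
          continuous_on_subset[OF smooth_on_imp_continuous[OF qs]]) auto
    then have "continuous_on ?A h"
      by (rule continuous_on_eq) (simp add: h_def)
    moreover have "continuous_on ?B h"
      by (rule continuous_on_eq[OF continuous_on_subset[OF smooth_on_imp_continuous[OF qs] subset_UNIV]])
        (use v_le_q in \<open>force simp: h_def max_def\<close>)
    moreover have "openin (top_of_set (?A \<union> ?B)) ?A" "openin (top_of_set (?A \<union> ?B)) ?B"
      unfolding AB by (auto intro!: openin_open_Int)
    ultimately have "continuous_on (?A \<union> ?B) h" by (intro continuous_on_Un_local_open)
    then show ?thesis unfolding AB .
  qed
  define \<zeta> where "\<zeta> = (\<lambda>z :: real^('n+'m). ereal (h (sel Inl z) + u \<bullet> sel Inr z))"
  have "continuous_on (cyl (closure \<Omega>)) (\<lambda>z :: real^('n+'m). h (sel Inl z))"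
    by (rule continuous_on_compose2[OF hcont]) (auto simp: cyl_iff intro!: continuous_intros)
  then have usc: "usc_on (cyl (closure \<Omega>)) \<zeta>"
    unfolding \<zeta>_def by (intro usc_on_continuous continuous_intros)
  have "hess g z \<in> star_psd F" if g: "test_function (cyl \<Omega>) \<zeta> z g" for g z
  proof (cases "h (sel Inl z) = q (sel Inl z)")
    case True
    show ?thesis
      by (rule hess_in_star_psd_at_lower_contact[OF F_mono open_UNIV qs UNIV_I hq _ _ g, of u])
        (simp add: \<zeta>_def True, simp add: \<zeta>_def h_def)
  next
    case False
    then have x: "sel Inl z \<in> ball \<tau> s" and hvx: "h (sel Inl z) = v (sel Inl z)"
      by (auto simp: h_def max_def split: if_splits)
    show ?thesis
      by (rule hess_in_star_psd_at_lower_contact[OF F_mono open_ball vs x hv[OF x] _ _ g, of u])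
        (simp add: \<zeta>_def hvx, simp add: \<zeta>_def h_def)
  qed
  moreover have "usc_on (cyl \<Omega>) \<zeta>"
    using usc by (rule usc_on_subset) (use closure_subset[of \<Omega>] in \<open>auto simp: cyl_iff\<close>)
  ultimately have sub: "subharmonic_on (star_psd F) (cyl \<Omega>) \<zeta>"
    by (simp add: subharmonic_on_def)
  have "\<zeta> (vjoin \<tau>' y) \<le> ereal (\<phi> \<tau>' y)" if \<tau>': "\<tau>' \<in> frontier \<Omega>" for \<tau>' y
  proof -
    have cl: "\<tau>' \<in> closure \<Omega>" using \<tau>' by (simp add: frontier_def)
    have "q \<tau>' + u \<bullet> y \<le> \<phi> \<tau>' y" using q_le[OF cl] K[OF \<tau>', of y] by simp
    moreover have "v \<tau>' + u \<bullet> y \<le> \<phi> \<tau>' y" if "\<tau>' \<in> ball \<tau> s"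
    proof -
      have "u \<bullet> y + (\<phi> \<tau> y\<^sub>0 - u \<bullet> y\<^sub>0) - \<epsilon> \<le> \<phi> \<tau>' y" by (rule near) (use \<tau>' that s in auto)
      then show ?thesis using v_le[of \<tau>'] cl that by (simp add: c_def)
    qed
    ultimately show ?thesis by (simp add: \<zeta>_def h_def max_def)
  qed
  then have "\<zeta> \<in> perron_family F \<Omega> \<phi>" using usc sub by (simp add: perron_family_def)
  then have "\<zeta> (vjoin \<tau> y\<^sub>0) \<le> perron_sup F \<Omega> \<phi> (vjoin \<tau> y\<^sub>0)"
    unfolding perron_sup_def by (rule SUP_upper)
  \<comment> \<open>As \<open>w\<close> vanishes at \<tau>, \<open>v\<close> equals \<open>c\<close>
    there, which leaves a loss of exactly \<epsilon>.\<close>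
  moreover have "ereal (\<phi> \<tau> y\<^sub>0 - \<epsilon>) \<le> \<zeta> (vjoin \<tau> y\<^sub>0)"
    using s(1) by (simp add: \<zeta>_def h_def v_def w c_def max_def)
  ultimately have "ereal (\<phi> \<tau> y\<^sub>0 - \<epsilon>) \<le> perron_sup F \<Omega> \<phi> (vjoin \<tau> y\<^sub>0)" by (rule order_trans[rotated])
  then show "ereal (\<phi> \<tau> y\<^sub>0) \<le> perron_sup F \<Omega> \<phi> (vjoin \<tau> y\<^sub>0) + ereal \<epsilon>"
    by (cases "perron_sup F \<Omega> \<phi> (vjoin \<tau> y\<^sub>0)") auto
qed

end

theorem proposition10p2:
  fixes F :: "(real^'n^'n) set"
    and \<Omega> :: "(real^'n) set"
    and \<phi> :: "real^'n \<Rightarrow> real^'m \<Rightarrow> real"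
  assumes "dirichlet_set F" and "convex F"
    and "open \<Omega>" and "bounded \<Omega>" and "smooth_boundary \<Omega>"
    and "continuous_on (frontier \<Omega> \<times> UNIV) (\<lambda>(\<tau>, y). \<phi> \<tau> y)"
    and "\<And>\<tau>. \<tau> \<in> frontier \<Omega> \<Longrightarrow> convex_on UNIV (\<phi> \<tau>)"
    and "strictly_bdry_convex (ray_set F) \<Omega>"
    and "strictly_bdry_convex (ray_set (dual_set F)) \<Omega>"
    and "locally_comparable (frontier \<Omega>) (\<lambda>\<tau>. legendre (\<phi> \<tau>))"
  shows "subharmonic_on (star_psd F) (cyl \<Omega>) (perron_sup F \<Omega> \<phi>)
    \<and> (\<forall>\<tau>\<in>frontier \<Omega>. \<forall>y. perron_sup F \<Omega> \<phi> (vjoin \<tau> y) = ereal (\<phi> \<tau> y))"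
proof -
  interpret perron_setting F \<Omega> \<phi>
    using assms by unfold_locales
  show ?thesis
  proof (intro conjI ballI allI antisym)
    show "subharmonic_on (star_psd F) (cyl \<Omega>) (perron_sup F \<Omega> \<phi>)"
      by (rule subharmonic_on_perron_sup[OF assms(9)])
    fix \<tau> y assume "\<tau> \<in> frontier \<Omega>"
    then show "perron_sup F \<Omega> \<phi> (vjoin \<tau> y) \<le> ereal (\<phi> \<tau> y)"
      and "ereal (\<phi> \<tau> y) \<le> perron_sup F \<Omega> \<phi> (vjoin \<tau> y)"
      by (rule perron_sup_le_boundary, intro perron_sup_ge_boundary assms)
  qed
qed

end
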